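(* The satisfiability problem of $\mathtt{PH}$ (Presburger arithmetic with Härtig quantifier) is reducible in exponential time both to $\mathrm{MC}(\mathtt{FKS},\mathtt{CLTL})$ and to $\mathrm{MC}(\mathtt{FKS},\mathtt{CCTL})$; that is, there are exponential-time computable maps sending each $\mathtt{PH}$ formula $\Phi$ to an instance $(\mathcal{K},\hat\Phi)$ of the respective model-checking problem such that $\Phi$ is satisfiable if and only if $\mathcal{K}\models\hat\Phi$.
   Context: $\mathtt{PH}$: formulae over a set of variables $V$ given by $\varphi ::= \tau\le\tau\mid\neg\varphi\mid\varphi\land\varphi\mid\exists x.\varphi\mid\exists^{=x}y.\varphi$, terms $\tau ::= a\mid a\cdot x\mid\tau+\tau$ with $a\in\mathbb{N}$, $x,y\in V$. Semantics over valuations $\eta:V\to\mathbb{N}$ as usual for first-order logic over $(\mathbb{N},+)$, and $\eta\models\exists^{=x}y.\varphi$ iff the set $\{b\in\mathbb{N}\mid\eta[y\mapsto b]\models\varphi\}$ is finite and has cardinality $\eta(x)$. Satisfiability: does some $\eta$ satisfy $\varphi$? Kripke structure $\mathcal{K}=(S,s_I,E,\lambda)$: finite $S$, $s_I\in S$, $E\subseteq S\times S$, $\lambda:S\to2^{AP}$ ($AP$ finite). Runs: infinite paths $\rho$ with $\rho(0)=s_I$; $\mathtt{Runs}(\mathcal{K})$. Simple loop: finite path of pairwise distinct states $s_0\dots s_k$ with $(s_k,s_0)\in E$; $\mathcal{K}$ is flat if each state is the first state of at most one simple loop; $\mathtt{FKS}$ is the class of flat Kripke structures. $\mathtt{CCTL^*}$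 over variables $V$: $\varphi ::= p\mid\varphi\land\varphi\mid\neg\varphi\mid\mathtt{X}\varphi\mid\varphi\mathtt{U}\varphi\mid\mathtt{E}\varphi\mid x.\varphi\mid\tau\le\tau$, $\tau ::= a\mid a\cdot\#_x(\varphi)\mid\tau+\tau$ ($p\in AP$, $x\in V$, $a\in\mathbb{Z}$). Semantics over a run $\rho$, position $i$, valuation $\theta:V\to\mathbb{N}$: $p$ iff $p\in\lambda(\rho(i))$; Booleans usual; $\mathtt{X}\varphi$ iff $(\rho,i+1,\theta)\models\varphi$; $\varphi\mathtt{U}\psi$ iff some $k\ge i$ has $(\rho,k,\theta)\models\psi$ and $(\rho,j,\theta)\models\varphi$ for all $j\in[i,k-1]$; $\mathtt{E}\varphi$ iff some $\rho'\in\mathtt{Runs}(\mathcal{K})$ agrees with $\rho$ on positions $0..i$ and $(\rho',i,\theta)\models\varphi$; $x.\varphi$ iff $(\rho,i,\theta[x\mapsto i])\models\varphi$; $\tau_1\le\tau_2$ iff $[\![\tau_1]\!]\le[\![\tau_2]\!]$, where $[\![a]\!]=a$, $[\![\tau_1+\tau_2]\!]$ is the sum, $[\![a\cdot\#_x(\varphi)]\!]=a\cdot|\{j\mid\theta(x)\le j\le i,(\rho,j,\theta)\models\varphi\}|$. Abbreviations: $\mathtt{A}\varphi=\neg\mathtt{E}\neg\varphi$, $\mathtt{F}\varphi=\top\mathtt{U}\varphi$, $\mathtt{G}\varphi=\neg\mathtt{F}\neg\varphi$. A state $s$ satisfies $\varphi$ if some $\rho\in\mathtt{Runs}(\mathcal{K})$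 and $i$ have $\rho(i)=s$ and $(\rho,i,\mathbf{0})\models\varphi$; $\mathcal{K}\models\varphi$ iff $s_I$ satisfies $\varphi$. $\mathtt{CLTL}$: $\mathtt{CCTL^*}$ formulae without $\mathtt{E},\mathtt{A}$. $\mathtt{CCTL}$: $\mathtt{CCTL^*}$ formulae in which every occurrence of $\mathtt{X}$ and $\mathtt{U}$ is immediately preceded by $\mathtt{E}$ or $\mathtt{A}$. $\mathrm{MC}(\mathfrak{K},\mathcal{L})$: given $\mathcal{K}\in\mathfrak{K}$, $\varphi\in\mathcal{L}$, decide $\mathcal{K}\models\varphi$. *)

theory Defs
  imports Main
begin

datatype ph_term = PConst nat | PMul nat nat | PAdd ph_term ph_term

datatype ph = PLe ph_term ph_term | PNot ph | PAnd ph ph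
  | PEx nat ph
  | PHaertig nat nat ph

primrec ph_tval :: "(nat \<Rightarrow> nat) \<Rightarrow> ph_term \<Rightarrow> nat" where
  "ph_tval \<eta> (PConst a) = a"
| "ph_tval \<eta> (PMul a x) = a * \<eta> x"
| "ph_tval \<eta> (PAdd s t) = ph_tval \<eta> s + ph_tval \<eta> t"

primrec ph_sat :: "(nat \<Rightarrow> nat) \<Rightarrow> ph \<Rightarrow> bool" where
  "ph_sat \<eta> (PLe s t) = (ph_tval \<eta> s \<le> ph_tval \<eta> t)"
| "ph_sat \<eta> (PNot f) = (\<not> ph_sat \<eta> f)"
| "ph_sat \<eta> (PAnd f g) = (ph_sat \<eta> f \<and> ph_sat \<eta> g)"
| "ph_sat \<eta> (PEx x f) = (\<exists>b. ph_sat (\<eta>(x := b)) f)"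
| "ph_sat \<eta> (PHaertig x y f) =
     (finite {b. ph_sat (\<eta>(y := b)) f} \<and> card {b. ph_sat (\<eta>(y := b)) f} = \<eta> x)"

definition ph_satisfiable :: "ph \<Rightarrow> bool" where
  "ph_satisfiable f \<longleftrightarrow> (\<exists>\<eta>. ph_sat \<eta> f)"

text \<open>States are 0..ks_n-1, atomic propositions are natural numbers,
  the label of state s is set (ks_label K ! s).\<close>
record kripke =
  ks_n :: nat
  ks_init :: nat
  ks_edges :: "(nat \<times> nat) list"
  ks_label :: "nat list list"

definition ks_wf :: "kripke \<Rightarrow> bool" where
  "ks_wf K \<longleftrightarrow> ks_init K < ks_n K \<and> (\<forall>(a,b)\<in>set (ks_edges K). a < ks_n K \<and> b < ks_n K)
      \<and> length (ks_label K) = ks_n K"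

definition ks_lab :: "kripke \<Rightarrow> nat \<Rightarrow> nat set" where
  "ks_lab K s = set (ks_label K ! s)"

definition is_run :: "kripke \<Rightarrow> (nat \<Rightarrow> nat) \<Rightarrow> bool" where
  "is_run K \<rho> \<longleftrightarrow> \<rho> 0 = ks_init K \<and> (\<forall>i. (\<rho> i, \<rho> (Suc i)) \<in> set (ks_edges K))"

definition simple_loop :: "kripke \<Rightarrow> nat list \<Rightarrow> bool" where
  "simple_loop K xs \<longleftrightarrow> xs \<noteq> [] \<and> distinct xs \<and> (\<forall>s\<in>set xs. s < ks_n K)
     \<and> (\<forall>i. Suc i < length xs \<longrightarrow> (xs ! i, xs ! Suc i) \<in> set (ks_edges K))
     \<and> (last xs, hd xs) \<in> set (ks_edges K)"

definition flat :: "kripke \<Rightarrow> bool" where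
  "flat K \<longleftrightarrow> (\<forall>s. \<forall>xs ys. simple_loop K xs \<and> simple_loop K ys \<and> hd xs = s \<and> hd ys = s
                 \<longrightarrow> xs = ys)"

datatype cf = Prop nat | CAnd cf cf | CNot cf | CX cf | CU cf cf | CE cf
  | CBind nat cf
  | CLe ct ct
and ct = CConst int | CCount int nat cf
  | CAdd ct ct

primrec csat :: "kripke \<Rightarrow> (nat \<Rightarrow> nat) \<Rightarrow> nat \<Rightarrow> (nat \<Rightarrow> nat) \<Rightarrow> cf \<Rightarrow> bool"
and ctval :: "kripke \<Rightarrow> (nat \<Rightarrow> nat) \<Rightarrow> nat \<Rightarrow> (nat \<Rightarrow> nat) \<Rightarrow> ct \<Rightarrow> int" where
  "csat K \<rho> i \<theta> (Prop p) = (p \<in> ks_lab K (\<rho> i))"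
| "csat K \<rho> i \<theta> (CAnd f g) = (csat K \<rho> i \<theta> f \<and> csat K \<rho> i \<theta> g)"
| "csat K \<rho> i \<theta> (CNot f) = (\<not> csat K \<rho> i \<theta> f)"
| "csat K \<rho> i \<theta> (CX f) = csat K \<rho> (Suc i) \<theta> f"
| "csat K \<rho> i \<theta> (CU f g) = (\<exists>k\<ge>i. csat K \<rho> k \<theta> g \<and> (\<forall>j. i \<le> j \<and> j < k \<longrightarrow> csat K \<rho> j \<theta> f))"
| "csat K \<rho> i \<theta> (CE f) = (\<exists>\<rho>'. is_run K \<rho>' \<and> (\<forall>j\<le>i. \<rho>' j = \<rho> j) \<and> csat K \<rho>' i \<theta> f)"
| "csat K \<rho> i \<theta> (CBind x f) = csat K \<rho> i (\<theta>(x := i)) f"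
| "csat K \<rho> i \<theta> (CLe s t) = (ctval K \<rho> i \<theta> s \<le> ctval K \<rho> i \<theta> t)"
| "ctval K \<rho> i \<theta> (CConst a) = a"
| "ctval K \<rho> i \<theta> (CCount a x f) = a * int (card {j. \<theta> x \<le> j \<and> j \<le> i \<and> csat K \<rho> j \<theta> f})"
| "ctval K \<rho> i \<theta> (CAdd s t) = ctval K \<rho> i \<theta> s + ctval K \<rho> i \<theta> t"

text \<open>A state s satisfies phi iff some run rho and position i have rho i = s and
  (rho, i, 0) satisfies phi; K models phi iff the initial state satisfies phi.\<close>
definition models :: "kripke \<Rightarrow> cf \<Rightarrow> bool" where
  "models K f \<longleftrightarrow> (\<exists>\<rho> i. is_run K \<rho> \<and> \<rho> i = ks_init K \<and> csat K \<rho> i (\<lambda>_. 0) f)"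

text \<open>CLTL: no path quantifier (A abbreviates not E not, so no E at all).\<close>
primrec is_cltl :: "cf \<Rightarrow> bool" and is_cltl_t :: "ct \<Rightarrow> bool" where
  "is_cltl (Prop p) = True"
| "is_cltl (CAnd f g) = (is_cltl f \<and> is_cltl g)"
| "is_cltl (CNot f) = is_cltl f"
| "is_cltl (CX f) = is_cltl f"
| "is_cltl (CU f g) = (is_cltl f \<and> is_cltl g)"
| "is_cltl (CE f) = False"
| "is_cltl (CBind x f) = is_cltl f"
| "is_cltl (CLe s t) = (is_cltl_t s \<and> is_cltl_t t)"
| "is_cltl_t (CConst a) = True"
| "is_cltl_t (CCount a x f) = is_cltl f"
| "is_cltl_t (CAdd s t) = (is_cltl_t s \<and> is_cltl_t t)"

text \<open>CCTL: every X and U is immediately preceded by E or by A (= CNot (CE (CNot _))).\<close>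
fun is_cctl :: "cf \<Rightarrow> bool" and is_cctl_t :: "ct \<Rightarrow> bool" where
  "is_cctl (Prop p) = True"
| "is_cctl (CAnd f g) = (is_cctl f \<and> is_cctl g)"
| "is_cctl (CNot (CE (CNot (CX f)))) = is_cctl f"
| "is_cctl (CNot (CE (CNot (CU f g)))) = (is_cctl f \<and> is_cctl g)"
| "is_cctl (CNot f) = is_cctl f"
| "is_cctl (CX f) = False"
| "is_cctl (CU f g) = False"
| "is_cctl (CE (CX f)) = is_cctl f"
| "is_cctl (CE (CU f g)) = (is_cctl f \<and> is_cctl g)"
| "is_cctl (CE f) = is_cctl f"
| "is_cctl (CBind x f) = is_cctl f"
| "is_cctl (CLe s t) = (is_cctl_t s \<and> is_cctl_t t)"
| "is_cctl_t (CConst a) = True"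
| "is_cctl_t (CCount a x f) = is_cctl f"
| "is_cctl_t (CAdd s t) = (is_cctl_t s \<and> is_cctl_t t)"

section \<open>Encodings as words over the alphabet {1..27} (0 is the blank)\<close>

fun bits :: "nat \<Rightarrow> nat list" where
  "bits n = (if n = 0 then [] else (n mod 2 + 1) # bits (n div 2))"

definition enc_nat :: "nat \<Rightarrow> nat list" where
  "enc_nat n = bits n @ [3]"

definition enc_int :: "int \<Rightarrow> nat list" where
  "enc_int a = (if a < 0 then 4 else 5) # enc_nat (nat \<bar>a\<bar>)"

definition enc_list :: "('a \<Rightarrow> nat list) \<Rightarrow> 'a list \<Rightarrow> nat list" where
  "enc_list e xs = concat (map (\<lambda>x. 6 # e x) xs) @ [7]"

primrec enc_pht :: "ph_term \<Rightarrow> nat list" where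
  "enc_pht (PConst a) = 8 # enc_nat a"
| "enc_pht (PMul a x) = 9 # enc_nat a @ enc_nat x"
| "enc_pht (PAdd s t) = 10 # enc_pht s @ enc_pht t"

primrec enc_ph :: "ph \<Rightarrow> nat list" where
  "enc_ph (PLe s t) = 11 # enc_pht s @ enc_pht t"
| "enc_ph (PNot f) = 12 # enc_ph f"
| "enc_ph (PAnd f g) = 13 # enc_ph f @ enc_ph g"
| "enc_ph (PEx x f) = 14 # enc_nat x @ enc_ph f"
| "enc_ph (PHaertig x y f) = 15 # enc_nat x @ enc_nat y @ enc_ph f"

primrec enc_cf :: "cf \<Rightarrow> nat list" and enc_ct :: "ct \<Rightarrow> nat list" where
  "enc_cf (Prop p) = 16 # enc_nat p"
| "enc_cf (CAnd f g) = 17 # enc_cf f @ enc_cf g"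
| "enc_cf (CNot f) = 18 # enc_cf f"
| "enc_cf (CX f) = 19 # enc_cf f"
| "enc_cf (CU f g) = 20 # enc_cf f @ enc_cf g"
| "enc_cf (CE f) = 21 # enc_cf f"
| "enc_cf (CBind x f) = 22 # enc_nat x @ enc_cf f"
| "enc_cf (CLe s t) = 23 # enc_ct s @ enc_ct t"
| "enc_ct (CConst a) = 24 # enc_int a"
| "enc_ct (CCount a x f) = 25 # enc_int a @ enc_nat x @ enc_cf f"
| "enc_ct (CAdd s t) = 26 # enc_ct s @ enc_ct t"

definition enc_kripke :: "kripke \<Rightarrow> nat list" where
  "enc_kripke K = 27 # enc_nat (ks_n K) @ enc_nat (ks_init K)
     @ enc_list (\<lambda>(a,b). enc_nat a @ enc_nat b) (ks_edges K)
     @ enc_list (enc_list enc_nat) (ks_label K)"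

definition enc_inst :: "kripke \<times> cf \<Rightarrow> nat list" where
  "enc_inst p = enc_kripke (fst p) @ enc_cf (snd p)"

datatype dir = Lft | Rgt | Stay

text \<open>States 0..<tm_Q (0 initial), tape symbols 0..<tm_G (0 blank).
  The machine halts when the transition function returns None.\<close>
record tm =
  tm_Q :: nat
  tm_G :: nat
  tm_delta :: "nat \<Rightarrow> nat \<Rightarrow> (nat \<times> nat \<times> dir) option"

definition tm_wf :: "tm \<Rightarrow> bool" where
  "tm_wf M \<longleftrightarrow> 0 < tm_Q M \<and> 28 \<le> tm_G M \<and>
     (\<forall>q a. q < tm_Q M \<longrightarrow> a < tm_G M \<longrightarrow>
        (case tm_delta M q a of None \<Rightarrow> True | Some (q', b, d) \<Rightarrow> q' < tm_Q M \<and> b < tm_G M))"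

text \<open>Configuration (q, ls, rs): ls is the tape left of the head (nearest first),
  the head reads the first symbol of rs (blank if rs = []).\<close>
type_synonym conf = "nat \<times> nat list \<times> nat list"

definition head_sym :: "nat list \<Rightarrow> nat" where
  "head_sym rs = (case rs of [] \<Rightarrow> 0 | a # _ \<Rightarrow> a)"

fun move :: "dir \<Rightarrow> nat list \<Rightarrow> nat list \<Rightarrow> nat list \<times> nat list" where
  "move Stay ls rs = (ls, rs)"
| "move Lft [] rs = ([], 0 # rs)"
| "move Lft (l # ls) rs = (ls, l # rs)"
| "move Rgt ls [] = (0 # ls, [])"
| "move Rgt ls (r # rs) = (r # ls, rs)"

definition next_conf :: "tm \<Rightarrow> conf \<Rightarrow> conf option" where
  "next_conf M c = (case c of (q, ls, rs) \<Rightarrow>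
     (case tm_delta M q (head_sym rs) of None \<Rightarrow> None
      | Some (q', b, d) \<Rightarrow> Some (q', move d ls (b # drop 1 rs))))"

primrec iter_conf :: "tm \<Rightarrow> nat \<Rightarrow> conf \<Rightarrow> conf" where
  "iter_conf M 0 c = c"
| "iter_conf M (Suc n) c = (case next_conf M c of None \<Rightarrow> c | Some c' \<Rightarrow> iter_conf M n c')"

definition output_of :: "conf \<Rightarrow> nat list" where
  "output_of c = (case c of (q, ls, rs) \<Rightarrow> takeWhile (\<lambda>a. a \<noteq> 0) rs)"

definition tm_computes_within :: "tm \<Rightarrow> nat list \<Rightarrow> nat list \<Rightarrow> nat \<Rightarrow> bool" where
  "tm_computes_within M w v t \<longleftrightarrow>
     next_conf M (iter_conf M t (0, [], w)) = None \<and> output_of (iter_conf M t (0, [], w)) = v"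

definition exptime_computable :: "('a \<Rightarrow> nat list) \<Rightarrow> ('b \<Rightarrow> nat list) \<Rightarrow> ('a \<Rightarrow> 'b) \<Rightarrow> bool" where
  "exptime_computable ein eout f \<longleftrightarrow>
     (\<exists>M k. tm_wf M \<and> (\<forall>x. tm_computes_within M (ein x) (eout (f x)) (2 ^ ((length (ein x) + 2) ^ k))))"

end

theory Submission
  imports Defs "HOL.Filter"
begin

text \<open>The Kripke structure is a single state with a self loop. It has one run, so \<open>E f\<close> is equivalent to
  \<open>f\<close>, and a number is a position of the run. A position formula is made independent of the
  current position by \<open>F G\<close>: at all large positions, \<open>#\<^sub>0\<close> of a formula counts all the numbers that
  satisfy it (or exceeds any bound), and the number \<open>\<theta> x\<close> itself is the count of the positions
  before \<open>x\<close>.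

  The Haertig quantifier compares a count with \<open>n\<close> from below and from above, which would double the
  subformula at each quantifier. Instead, every subformula \<open>f\<close> becomes a term with value
  \<open>f xor mode\<close>, where the mode is stored in a variable; "at most \<open>n\<close>" is a lower bound on
  the count of the negation, so one copy of \<open>f\<close>, read under both modes, suffices. As formulas are
  encoded in prefix notation, the resulting map on words is computed by a two-way finite transducer,
  which a Turing machine simulates in polynomial time.\<close>

section \<open>Two-way transducers on Turing machines\<close>

inductive reach :: "('c \<Rightarrow> 'c option) \<Rightarrow> nat \<Rightarrow> 'c \<Rightarrow> 'c \<Rightarrow> bool" for f where
  reach_refl: "reach f n c c"
| reach_step: "f c = Some c' \<Longrightarrow> reach f n c' c'' \<Longrightarrow> reach f (Suc n) c c''"

lemma reach_mono: "reach f n c c' \<Longrightarrow> n \<le> m \<Longrightarrow> reach f m c c'"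
proof (induction arbitrary: m rule: reach.induct)
  case (reach_refl n c)
  show ?case by (rule reach.reach_refl)
next
  case (reach_step c c' n c'')
  then obtain m' where "m = Suc m'" "n \<le> m'" by (cases m) auto
  then show ?case using reach_step by (auto intro: reach.reach_step)
qed

lemma reach_trans: "reach f n c c' \<Longrightarrow> reach f m c' c'' \<Longrightarrow> reach f (n + m) c c''"
proof (induction rule: reach.induct)
  case (reach_refl n c)
  then show ?case by (auto elim: reach_mono)
qed (auto intro: reach.reach_step)

lemma reach_one: "f c = Some c' \<Longrightarrow> 1 \<le> n \<Longrightarrow> reach f n c c'"
  by (cases n) (auto intro: reach.intros)

text \<open>\<open>reach\<close> only bounds the number of steps from above; since
  \<open>iter_conf\<close> stays in a halting configuration, spare steps do no harm.\<close>

lemma iter_conf_reach: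
  "reach (next_conf M) n c c' \<Longrightarrow> next_conf M c' = None \<Longrightarrow> iter_conf M n c = c'"
proof (induction rule: reach.induct)
  case (reach_refl n c)
  then show ?case by (cases n) auto
qed auto

section \<open>Machines whose states form an arbitrary finite set\<close>

definition gstep :: "('s \<Rightarrow> nat \<Rightarrow> ('s \<times> nat \<times> dir) option) \<Rightarrow> 's \<times> nat list \<times> nat list
    \<Rightarrow> ('s \<times> nat list \<times> nat list) option" where
  "gstep D c = (case c of (s, ls, rs) \<Rightarrow>
     (case D s (head_sym rs) of None \<Rightarrow> None
      | Some (s', b, d) \<Rightarrow> Some (s', move d ls (b # drop 1 rs))))"

text \<open>The states of \<open>Q\<close> are numbered and runs are carried over step by step. The
  0 in \<open>output_of\<close> is a dummy state, as the output depends on the tape alone.\<close>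

lemma tm_of_gstep:
  fixes D :: "'s \<Rightarrow> nat \<Rightarrow> ('s \<times> nat \<times> dir) option"
  assumes fin: "finite Q" and s0: "s0 \<in> Q" and G: "28 \<le> G"
    and closed: "\<And>s a s' b d. s \<in> Q \<Longrightarrow> a < G \<Longrightarrow> D s a = Some (s', b, d) \<Longrightarrow> s' \<in> Q \<and> b < G"
  shows "\<exists>M. tm_wf M \<and> (\<forall>w v ls rs s n. set w \<subseteq> {..<G} \<longrightarrow>
            reach (gstep D) n (s0, [], w) (s, ls, rs) \<longrightarrow> gstep D (s, ls, rs) = None \<longrightarrow>
            output_of (0, ls, rs) = v \<longrightarrow> tm_computes_within M w v n)"
proof -
  obtain h0 :: "'s \<Rightarrow> nat" and N where h0: "h0 ` (Q - {s0}) = {i. i < N}" "inj_on h0 (Q - {s0})"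
    using finite_imp_inj_to_nat_seg[of "Q - {s0}"] fin by auto
  \<comment> \<open>The initial state of a \<open>tm\<close> is 0, so \<open>s0\<close> gets 0 and
    all other numbers are shifted up.\<close>
  define h where "h s = (if s = s0 then 0 else Suc (h0 s))" for s
  have inj: "inj_on h Q" using h0(2) by (auto simp: inj_on_def h_def)
  have lt: "h s < Suc N" if "s \<in> Q" for s
    using h0(1) that by (auto simp: h_def)
  define g where "g = inv_into Q h"
  have g: "g (h s) = s" if "s \<in> Q" for s using inj that by (simp add: g_def)
  define M where "M = \<lparr>tm_Q = Suc N, tm_G = G, tm_delta = (\<lambda>q a.
     if q \<in> h ` Q \<and> a < G then map_option (\<lambda>(s, b, d). (h s, b, d)) (D (g q) a) else None)\<rparr>"
  have wf: "tm_wf M" unfolding tm_wf_def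
  proof (intro conjI allI impI)
    fix q a assume "q < tm_Q M" "a < tm_G M"
    show "case tm_delta M q a of None \<Rightarrow> True | Some (q', b, d) \<Rightarrow> q' < tm_Q M \<and> b < tm_G M"
    proof (cases "q \<in> h ` Q \<and> a < G")
      case True
      then have "g q \<in> Q" using g by auto
      then show ?thesis using closed[of "g q" a] lt True
        by (cases "D (g q) a") (auto simp: M_def)
    qed (auto simp: M_def)
  qed (use G in \<open>auto simp: M_def\<close>)
  have move_G: "set (fst (move d ls rs)) \<subseteq> {..<G} \<and> set (snd (move d ls rs)) \<subseteq> {..<G}"
    if "set ls \<subseteq> {..<G}" "set rs \<subseteq> {..<G}" for d ls rs
    using that G by (cases "(d, ls, rs)" rule: move.cases) auto
  have step: "next_conf M (h s, ls, rs) = map_option (\<lambda>(s, c). (h s, c)) (gstep D (s, ls, rs))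
      \<and> (\<forall>s' ls' rs'. gstep D (s, ls, rs) = Some (s', ls', rs') \<longrightarrow>
            s' \<in> Q \<and> set ls' \<subseteq> {..<G} \<and> set rs' \<subseteq> {..<G})"
    if "s \<in> Q" "set ls \<subseteq> {..<G}" "set rs \<subseteq> {..<G}" for s ls rs
  proof -
    have a: "head_sym rs < G" using that G by (cases rs) (auto simp: head_sym_def)
    show ?thesis
    proof (cases "D s (head_sym rs)")
      case None
      then show ?thesis by (auto simp: next_conf_def gstep_def M_def g that)
    next
      case (Some r)
      obtain s' b d where r: "r = (s', b, d)" by (cases r)
      have c: "s' \<in> Q" "b < G" using closed[OF that(1) a] Some r by auto
      have "set (b # drop 1 rs) \<subseteq> {..<G}"
        using c(2) that(3) set_drop_subset[of 1 rs] by auto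
      from move_G[OF that(2) this, of d] show ?thesis
        using Some r c a that by (auto simp: next_conf_def gstep_def M_def g)
    qed
  qed
  have sim: "reach (next_conf M) n (h s, ls, rs) (h s', ls', rs')
      \<and> s' \<in> Q \<and> set ls' \<subseteq> {..<G} \<and> set rs' \<subseteq> {..<G}"
    if "reach (gstep D) n (s, ls, rs) (s', ls', rs')" "s \<in> Q" "set ls \<subseteq> {..<G}" "set rs \<subseteq> {..<G}"
    for n s ls rs s' ls' rs'
    using that
  proof (induction n "(s, ls, rs)" "(s', ls', rs')" arbitrary: s ls rs rule: reach.induct)
    case (reach_refl n)
    then show ?case by (auto intro: reach.intros)
  next
    case (reach_step c' n)
    obtain s1 l1 r1 where c': "c' = (s1, l1, r1)" by (cases c')
    from step[OF reach_step(4-6)] reach_step(1) c'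
    have 1: "next_conf M (h s, ls, rs) = Some (h s1, l1, r1)"
      "s1 \<in> Q" "set l1 \<subseteq> {..<G}" "set r1 \<subseteq> {..<G}" by auto
    from reach_step(3)[OF c' 1(2-4)] reach.reach_step[of "next_conf M", OF 1(1)]
    show ?case by auto
  qed
  have "tm_computes_within M w v n"
    if "set w \<subseteq> {..<G}" "reach (gstep D) n (s0, [], w) (s, ls, rs)" "gstep D (s, ls, rs) = None"
      "output_of (0, ls, rs) = v" for w v ls rs s n
  proof -
    have r: "reach (next_conf M) n (0, [], w) (h s, ls, rs)"
      "s \<in> Q" "set ls \<subseteq> {..<G}" "set rs \<subseteq> {..<G}"
      using sim[OF that(2) s0] that(1) by (auto simp: h_def)
    have N: "next_conf M (h s, ls, rs) = None" using step[OF r(2-4)] that(3) by simp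
    show ?thesis unfolding tm_computes_within_def iter_conf_reach[OF r(1) N]
      using N that(4) by (simp add: output_of_def)
  qed
  then show ?thesis using wf by blast
qed

section \<open>Simulating a two-way transducer on one tape\<close>

type_synonym 'q transducer = "'q \<Rightarrow> nat \<Rightarrow> ('q \<times> nat list \<times> dir) option"

definition dstep :: "'q transducer \<Rightarrow> 'q \<times> nat list \<times> nat list \<times> nat list
    \<Rightarrow> ('q \<times> nat list \<times> nat list \<times> nat list) option" where
  "dstep \<delta> c = (case c of (q, ls, rs, out) \<Rightarrow>
     (case \<delta> q (head_sym rs) of None \<Rightarrow> None
      | Some (q', u, d) \<Rightarrow> (case move d ls rs of (ls', rs') \<Rightarrow> Some (q', ls', rs', out @ u))))"

text \<open>The input is enclosed in the end markers 0 and 28; the output is appended to the right of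
  28, while the cell to come back to is marked by adding 29.\<close>

datatype 'q ctl = Seek | Back | Run 'q | App 'q dir "nat list" | Ret 'q dir | Fin

text \<open>\<open>App\<close> runs to the first blank and writes the pending word;
  \<open>Ret\<close> returns to the marked cell, restores it, and only then makes the move
  \<open>d\<close> of the transducer. The symbols 0 to 28 and their marked copies make an alphabet
  of size 58.\<close>

fun ctl_delta :: "'q transducer \<Rightarrow> 'q \<Rightarrow> 'q ctl \<Rightarrow> nat \<Rightarrow> ('q ctl \<times> nat \<times> dir) option" where
  "ctl_delta \<delta> q0 Seek a = Some (if a = 0 then (Back, 28, Stay) else (Seek, a, Rgt))"
| "ctl_delta \<delta> q0 Back a = Some (if a = 0 then (Run q0, 0, Stay) else (Back, a, Lft))"
| "ctl_delta \<delta> q0 (Run q) a = (if a \<ge> 29 then None else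
     case \<delta> q a of None \<Rightarrow> Some (Fin, a, Rgt)
     | Some (q', u, d) \<Rightarrow> Some (if u = [] then (Run q', a, d) else (App q' d u, a + 29, Rgt)))"
| "ctl_delta \<delta> q0 (App q d u) a = (if a \<noteq> 0 then Some (App q d u, a, Rgt) else
     case u of [] \<Rightarrow> None
     | b # u' \<Rightarrow> Some (if u' = [] then (Ret q d, b, Stay) else (App q d u', b, Rgt)))"
| "ctl_delta \<delta> q0 (Ret q d) a = Some (if a \<ge> 29 then (Run q, a - 29, d) else (Ret q d, a, Lft))"
| "ctl_delta \<delta> q0 Fin a = None"

locale two_way =
  fixes \<delta> :: "'q::finite transducer" and q0 :: 'q and B :: nat
  assumes out: "\<delta> q a = Some (q', u, d) \<Longrightarrow> length u \<le> B \<and> set u \<subseteq> {1..27}"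
    and left_end: "\<delta> q 0 = Some (q', u, d) \<Longrightarrow> d \<noteq> Lft"
    and right_end: "\<delta> q 28 = Some (q', u, d) \<Longrightarrow> d \<noteq> Rgt"
begin

abbreviation D where "D \<equiv> ctl_delta \<delta> q0"

lemma gstep_D:
  "gstep D (s, ls, []) = map_option (\<lambda>(s', b, d). (s', move d ls [b])) (D s 0)"
  "gstep D (s, ls, a # rs) = map_option (\<lambda>(s', b, d). (s', move d ls (b # rs))) (D s a)"
  by (auto simp: gstep_def head_sym_def split: option.splits)

lemma seek_end:
  "0 \<notin> set w \<Longrightarrow> reach (gstep D) (length w + 1) (Seek, ls, w) (Back, rev w @ ls, [28])"
proof (induction w arbitrary: ls)
  case Nil
  show ?case by (rule reach_one) (auto simp: gstep_D)
next
  case (Cons a w)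
  then show ?case using Cons.IH[of "a # ls"] reach_step[of "gstep D" "(Seek, ls, a # w)"]
    by (simp add: gstep_D)
qed

text \<open>Moving left from an empty left part pads a blank, and this new cell is the left end
  marker.\<close>

lemma back_start:
  "0 \<notin> set (r # w) \<Longrightarrow>
     reach (gstep D) (length w + 2) (Back, w, r # Z) (Run q0, [], 0 # rev w @ r # Z)"
proof (induction w arbitrary: r Z)
  case Nil
  then show ?case
    using reach_trans[of "gstep D" 1 "(Back, [], r # Z)" "(Back, [], 0 # r # Z)" 1 "(Run q0, [], 0 # r # Z)"]
    by (simp add: gstep_D reach_one)
next
  case (Cons a w)
  then show ?case using Cons.IH[of a "r # Z"] reach_step[of "gstep D" "(Back, a # w, r # Z)"]
    by (simp add: gstep_D)
qed

lemma app_move: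
  "0 \<notin> set X \<Longrightarrow> reach (gstep D) (length X) (App q d u, ls, X) (App q d u, rev X @ ls, [])"
proof (induction X arbitrary: ls)
  case Nil
  show ?case by (auto intro: reach_refl)
next
  case (Cons a X)
  then show ?case using Cons.IH[of "a # ls"] reach_step[of "gstep D" "(App q d u, ls, a # X)"]
    by (simp add: gstep_D)
qed

lemma app_write:
  "u \<noteq> [] \<Longrightarrow> reach (gstep D) (length u) (App q d u, ls, [])
     (Ret q d, rev (butlast u) @ ls, [last u])"
proof (induction u arbitrary: ls)
  case (Cons a u)
  show ?case
  proof (cases "u = []")
    case True
    then show ?thesis by (auto intro!: reach_one simp: gstep_D)
  next
    case False
    then show ?thesis using Cons.IH[of "a # ls"] reach_step[of "gstep D" "(App q d (a # u), ls, [])"]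
      by (simp add: gstep_D)
  qed
qed simp

lemma ret:
  "\<forall>b\<in>set (r # Y). b < 29 \<Longrightarrow> m \<ge> 29 \<Longrightarrow>
     reach (gstep D) (length Y + 2) (Ret q d, Y @ m # ls, r # Z)
       (Run q, move d ls ((m - 29) # rev Y @ r # Z))"
proof (induction Y arbitrary: r Z)
  case Nil
  then show ?case
    using reach_trans[of "gstep D" 1 "(Ret q d, m # ls, r # Z)" "(Ret q d, ls, m # r # Z)" 1]
    by (simp add: gstep_D reach_one)
next
  case (Cons a Y)
  then show ?case using Cons.IH[of a "r # Z"] reach_step[of "gstep D" "(Ret q d, a # Y @ m # ls, r # Z)"]
    by (simp add: gstep_D)
qed

text \<open>The cost is a trip to the end of the output and back. The symbols of \<open>X\<close>
  must be nonzero, or else \<open>App\<close> would stop too early.\<close>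

lemma run_step:
  assumes d: "\<delta> q a = Some (q', u, d)" and a: "a < 29" and X: "\<forall>b\<in>set X. 0 < b \<and> b < 29"
  shows "reach (gstep D) (2 * (length X + length u) + 2) (Run q, ls, a # X)
           (Run q', move d ls (a # X @ u))"
proof (cases "u = []")
  case True
  then show ?thesis using d a by (auto intro!: reach_one simp: gstep_D)
next
  case False
  have u: "\<forall>b\<in>set u. 0 < b \<and> b < 29" using out[OF d] by fastforce
  have "reach (gstep D) 1 (Run q, ls, a # X) (App q' d u, (a + 29) # ls, X)"
    using d a False by (auto intro!: reach_one simp: gstep_D)
  from reach_trans[OF this app_move] X
  have "reach (gstep D) (1 + length X) (Run q, ls, a # X)
      (App q' d u, rev X @ (a + 29) # ls, [])" by fastforce
  note reach_trans[OF this app_write[OF False]]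
  moreover have "reach (gstep D) (length (rev (butlast u) @ rev X) + 2)
     (Ret q' d, (rev (butlast u) @ rev X) @ (a + 29) # ls, [last u])
     (Run q', move d ls ((a + 29 - 29) # rev (rev (butlast u) @ rev X) @ [last u]))"
    using u X False in_set_butlastD[of _ u] by (intro ret) auto
  ultimately have "reach (gstep D) (1 + length X + length u + (length (rev (butlast u) @ rev X) + 2))
     (Run q, ls, a # X) (Run q', move d ls ((a + 29 - 29) # rev (rev (butlast u) @ rev X) @ [last u]))"
    by (auto dest: reach_trans)
  then show ?thesis
    using False by (auto elim!: reach_mono simp: Suc_diff_Suc)
qed

text \<open>\<open>Z\<close> bounds the length of the output throughout, hence the length of every
  trip. The invariant keeps the head on the marked input, with the output right behind it.\<close>

lemma simulation:
  assumes "reach (dstep \<delta>) n (q, ls, rs, O1) (q', ls', rs', O2)"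
    and "rev ls @ rs = 0 # w @ [28]" "rs \<noteq> []" "set w \<subseteq> {1..27}" "set O1 \<subseteq> {1..27}"
    and "length O1 + n * B \<le> Z"
  shows "reach (gstep D) (n * (2 * (length w + 2 + Z) + 2)) (Run q, ls, rs @ O1) (Run q', ls', rs' @ O2)
     \<and> rev ls' @ rs' = 0 # w @ [28] \<and> rs' \<noteq> [] \<and> set O2 \<subseteq> {1..27}"
  using assms
proof (induction n "(q, ls, rs, O1)" "(q', ls', rs', O2)" arbitrary: q ls rs O1 rule: reach.induct)
  case (reach_refl n)
  then show ?case by (auto intro: reach.intros)
next
  case (reach_step c' n)
  obtain a X where rs: "rs = a # X" using reach_step(5) by (cases rs) auto
  obtain q1 u d where d: "\<delta> q a = Some (q1, u, d)"
    using reach_step(1) by (auto simp: dstep_def rs head_sym_def split: option.splits)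
  obtain l1 r1 where m: "move d ls rs = (l1, r1)" by (cases "move d ls rs")
  have c': "c' = (q1, l1, r1, O1 @ u)"
    using reach_step(1) d m by (auto simp: dstep_def rs head_sym_def)
  have tape: "rev ls @ a # X = 0 # w @ [28]" using reach_step(4) rs by simp
  \<comment> \<open>The only 0 is the left end marker, so it never lies strictly to the right of the
    head.\<close>
  have sub: "a < 29 \<and> (\<forall>b\<in>set X. 0 < b \<and> b < 29)"
  proof (cases ls rule: rev_cases)
    case Nil
    then show ?thesis using tape reach_step(6) by fastforce
  next
    case (snoc l b)
    then have "rev l @ a # X = w @ [28]" using tape by simp
    then have "set (rev l @ a # X) = set (w @ [28])" by (rule arg_cong)
    then have "a \<in> set (w @ [28]) \<and> set X \<subseteq> set (w @ [28])" by auto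
    then show ?thesis using reach_step(6) by fastforce
  qed
  have u: "length u \<le> B" "set u \<subseteq> {1..27}" using out[OF d] by auto
  have L: "ls = [] \<Longrightarrow> a = 0" using tape by auto
  have R: "X = [] \<Longrightarrow> a = 28" using tape by (metis append_Cons last.simps last_appendR list.distinct(1) last_snoc)
  \<comment> \<open>The end marker conditions keep the head on the input, so appending the output to
    the right part does not change the move.\<close>
  have inv: "rev l1 @ r1 = 0 # w @ [28] \<and> r1 \<noteq> [] \<and> move d ls (rs @ O1 @ u) = (l1, r1 @ O1 @ u)"
    using m tape left_end[of q q1 u d] right_end[of q q1 u d] d L R
    by (cases d; cases ls; cases X) (auto simp: rs)
  have lenX: "length X \<le> length w + 1"
    using arg_cong[OF tape, of length] by simp
  have B: "length (O1 @ u) + n * B \<le> Z" using reach_step(8) u by simp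
  have "reach (gstep D) (2 * (length (X @ O1) + length u) + 2) (Run q, ls, a # X @ O1)
           (Run q1, move d ls (a # (X @ O1) @ u))"
    using sub reach_step(7) by (intro run_step[OF d]) fastforce+
  then have "reach (gstep D) (2 * (length w + 2 + Z) + 2) (Run q, ls, rs @ O1) (Run q1, l1, r1 @ O1 @ u)"
    using inv lenX B by (auto elim!: reach_mono simp: rs)
  moreover note reach_step(3)[OF c' _ _ reach_step(6) _ B]
  ultimately show ?case using inv u reach_step(7) by (auto dest: reach_trans)
qed

text \<open>\<open>App\<close> carries a word, which makes the type of control states infinite;
  bounding the word by \<open>B\<close> leaves a finite set.\<close>

definition ctl_states :: "'q ctl set" where
  "ctl_states = {Seek, Back, Fin} \<union> range Run \<union> range (\<lambda>(q, d). Ret q d)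
     \<union> (\<lambda>(q, d, u). App q d u) ` (UNIV \<times> UNIV \<times> {u. set u \<subseteq> {1..27} \<and> length u \<le> B})"

lemma finite_ctl_states: "finite ctl_states"
proof -
  have "(UNIV :: dir set) = {Lft, Rgt, Stay}" by (auto intro: dir.exhaust)
  then have "finite (UNIV :: dir set)" by (metis finite.emptyI finite.insertI)
  then show ?thesis
    unfolding ctl_states_def by (auto simp: finite_lists_length_le simp flip: UNIV_Times_UNIV)
qed

lemma ctl_states_closed:
  assumes "s \<in> ctl_states" "a < 58" "D s a = Some (s', b, d)"
  shows "s' \<in> ctl_states \<and> b < 58"
proof (cases s)
  case (Run q)
  then show ?thesis using assms out[of q a]
    by (auto simp: ctl_states_def image_iff split: option.splits if_splits) blast
next
  case (App q d' u)
  then show ?thesis using assms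
    by (fastforce simp: ctl_states_def image_iff split: list.splits if_splits)
qed (use assms in \<open>auto simp: ctl_states_def image_iff split: if_splits\<close>)

end

section \<open>From quadratic to exponential time bounds\<close>

lemma quadratic_le_exp:
  assumes "m \<ge> (2::nat)"
  shows "C * m ^ 2 \<le> 2 ^ (m ^ (C + 2))"
proof -
  have "C * m ^ 2 \<le> 2 ^ C * (2 ^ m) ^ 2"
    by (intro mult_mono power_mono) (auto simp: less_imp_le)
  also have "\<dots> = 2 ^ (C + m * 2)" by (simp add: power_add power_mult)
  also have "\<dots> \<le> 2 ^ (m ^ (C + 2))"
  proof (rule power_increasing)
    have "C + m * 2 \<le> (m * 2) * (C + 1)" using assms by (simp add: algebra_simps)
    also have "\<dots> \<le> (m * m) * m ^ C"
    proof (rule mult_mono)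
      have "C + 1 \<le> 2 ^ C" by (induction C) auto
      also have "\<dots> \<le> m ^ C" using assms by (intro power_mono) auto
      finally show "C + 1 \<le> m ^ C" .
    qed (use assms in auto)
    finally show "C + m * 2 \<le> m ^ (C + 2)" by (simp add: power_add power2_eq_square algebra_simps)
  qed simp
  finally show ?thesis .
qed

text \<open>Linearly many transducer steps leave an output of linear length, so each of them is
  simulated in linear time and the total is quadratic.\<close>

lemma (in two_way) exptime_computableI:
  assumes run: "\<And>x. \<exists>ls. reach (dstep \<delta>) (c * (length (ein x) + 2)) (q0, [], 0 # ein x @ [28], [])
                      (qf, ls, [28], eout (f x))"
    and halt: "\<delta> qf 28 = None"
    and ein: "\<And>x. set (ein x) \<subseteq> {1..27}"
  shows "exptime_computable ein eout f"
proof -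
  have "Seek \<in> ctl_states" by (simp add: ctl_states_def)
  from tm_of_gstep[OF finite_ctl_states this, of 58 D] ctl_states_closed
  obtain M where M: "tm_wf M" "\<And>w v ls rs s n. set w \<subseteq> {..<58} \<Longrightarrow>
            reach (gstep D) n (Seek, [], w) (s, ls, rs) \<Longrightarrow> gstep D (s, ls, rs) = None \<Longrightarrow>
            output_of (0, ls, rs) = v \<Longrightarrow> tm_computes_within M w v n"
    by fastforce
  \<comment> \<open>Set-up and halting take \<open>2 * m\<close> steps and the simulation
    \<open>c * m * (2 * (m + c * m * B) + 2)\<close>; \<open>m \<le> m ^ 2\<close> turns the sum
    into a multiple of \<open>m ^ 2\<close>.\<close>
  define C where "C = 4 + c * (4 + 2 * c * B)"
  have "tm_computes_within M (ein x) (eout (f x)) (2 ^ ((length (ein x) + 2) ^ (C + 2)))" for x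
  proof -
    let ?w = "ein x"
    define m where "m = length ?w + 2"
    obtain ls where r: "reach (dstep \<delta>) (c * m) (q0, [], 0 # ?w @ [28], []) (qf, ls, [28], eout (f x))"
      using run m_def by auto
    have z: "0 \<notin> set ?w" using ein[of x] by fastforce
    have 1: "reach (gstep D) (length ?w + 1 + (length ?w + 2)) (Seek, [], ?w) (Run q0, [], 0 # ?w @ [28])"
      using reach_trans[OF seek_end[OF z, of "[]"] back_start[of 28 "rev ?w @ []" "[]"]] z by simp
    from simulation[OF r, of ?w "c * m * B"] ein[of x]
    have 2: "reach (gstep D) (c * m * (2 * (m + c * m * B) + 2))
        (Run q0, [], 0 # ?w @ [28]) (Run qf, ls, [28] @ eout (f x))"
      and o: "set (eout (f x)) \<subseteq> {1..27}" by (auto simp: m_def)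
    have 3: "reach (gstep D) 1 (Run qf, ls, [28] @ eout (f x)) (Fin, 28 # ls, eout (f x))"
      using halt by (intro reach_one) (auto simp: gstep_D)
    have "2 * m + (c * m * (2 * (m + c * m * B) + 2)) \<le> C * m ^ 2"
    proof -
      have "m \<le> m ^ 2" by (simp add: power2_eq_square)
      then have "m * 2 \<le> m * (m * 4)" "c * (m * 2) \<le> c * (m * (m * 2))"
        by (auto simp: power2_eq_square)
      from add_mono[OF this] show ?thesis by (simp add: C_def algebra_simps power2_eq_square)
    qed
    also have "\<dots> \<le> 2 ^ (m ^ (C + 2))" by (rule quadratic_le_exp) (simp add: m_def)
    finally have t: "2 * m + (c * m * (2 * (m + c * m * B) + 2)) \<le> 2 ^ (m ^ (C + 2))" .
    have r': "reach (gstep D) (2 ^ (m ^ (C + 2))) (Seek, [], ?w) (Fin, 28 # ls, eout (f x))"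
      by (rule reach_mono[OF reach_trans[OF reach_trans[OF 1 2] 3]]) (use t m_def in simp)
    have o': "takeWhile (\<lambda>a. a \<noteq> 0) (eout (f x)) = eout (f x)"
      unfolding takeWhile_eq_all_conv
    proof
      fix a assume "a \<in> set (eout (f x))"
      then have "a \<in> {1..27}" using o by blast
      then show "a \<noteq> 0" by simp
    qed
    have w: "set ?w \<subseteq> {..<58}" using ein[of x] by fastforce
    show ?thesis unfolding m_def[symmetric]
      by (rule M(2)[OF w r']) (simp add: gstep_def, simp only: output_of_def prod.case o')
  qed
  then show ?thesis unfolding exptime_computable_def using M(1) by blast
qed

section \<open>The translation\<close>

definition loop :: kripke where
  "loop = \<lparr>ks_n = 1, ks_init = 0, ks_edges = [(0, 0)], ks_label = [[0]]\<rparr>"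

lemma is_run_loop: "is_run loop \<rho> \<longleftrightarrow> \<rho> = (\<lambda>_. 0)"
proof
  assume r: "is_run loop \<rho>"
  have "\<rho> i = 0" for i using r by (cases i) (auto simp: is_run_def loop_def)
  then show "\<rho> = (\<lambda>_. 0)" by auto
qed (auto simp: is_run_def loop_def)

lemma ks_wf_loop: "ks_wf loop"
  by (simp add: ks_wf_def loop_def)

lemma flat_loop: "flat loop"
proof -
  have "xs = [0]" if "simple_loop loop xs" for xs
  proof -
    have "set xs \<subseteq> {0}" "distinct xs" "xs \<noteq> []"
      using that by (auto simp: simple_loop_def loop_def)
    then show ?thesis by (cases xs; cases "tl xs") auto
  qed
  then show ?thesis by (auto simp: flat_def)
qed

abbreviation true_cf :: cf where "true_cf \<equiv> Prop 0"

text \<open>A path quantifier has no effect on the single run, so one flag yields the CLTL and the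
  CCTL version of every formula.\<close>

definition until :: "bool \<Rightarrow> cf \<Rightarrow> cf \<Rightarrow> cf" where
  "until e f g = (if e then CE (CU f g) else CU f g)"

abbreviation "sat \<equiv> csat loop (\<lambda>_. 0)"
abbreviation "val \<equiv> ctval loop (\<lambda>_. 0)"

definition ev :: "bool \<Rightarrow> cf \<Rightarrow> cf" where "ev e f = until e true_cf f"
definition evalways :: "bool \<Rightarrow> cf \<Rightarrow> cf" where "evalways e f = ev e (CNot (ev e (CNot f)))"
definition cnt :: "nat \<Rightarrow> cf \<Rightarrow> ct" where "cnt x f = CCount 1 x f"
definition one :: ct where "one = CConst 1"

text \<open>The variable 0 is never bound, so \<open>#\<^sub>0\<close> counts from the start of the run. The mode is
  the value (0 or 1) of variable 2, and variable 4 saves the mode of the enclosing formula.\<close>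

definition at0 :: cf where "at0 = CLe (cnt 0 true_cf) one"
definition at01 :: cf where "at01 = CLe (cnt 0 true_cf) (CConst 2)"
definition at_var :: "nat \<Rightarrow> cf" where
  "at_var x = CAnd (CLe one (cnt x true_cf)) (CLe (cnt x true_cf) one)"
definition before :: "nat \<Rightarrow> cf" where "before x = CLe (cnt x true_cf) (CConst 0)"
text \<open>Only position 0 is counted, so the value is 0 or 1 and the same at every position; this
  allows its use inside other counts.\<close>

definition ind :: "cf \<Rightarrow> ct" where "ind f = cnt 0 (CAnd at0 f)"
definition holds :: "ct \<Rightarrow> cf" where "holds t = CLe one t"

text \<open>Reads \<open>f\<close> under the current mode. It doubles \<open>f\<close>, and is
  therefore applied only to comparisons of terms and to the bound of a count, never to a translated
  subformula.\<close>

definition flip :: "cf \<Rightarrow> cf" where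
  "flip f = CAnd (CNot (CAnd (holds (cnt 2 at0)) (CNot f)))
                 (CNot (CAnd (CNot (holds (cnt 2 at0))) f))"

text \<open>Binding stores the current position, so going to position \<open>\<theta> 2\<close> and
  binding 4 there copies the mode. The count over \<open>at01\<close> tries 0 and 1 as inner modes;
  its threshold, 2 or 1 depending on the outer mode, makes it a conjunction or a disjunction. In the
  innermost comparison \<open>one\<close> and \<open>cnt 4 at0\<close> cancel in outer mode 0 and
  leave a strict inequality in outer mode 1.\<close>

definition hterm :: "bool \<Rightarrow> cf \<Rightarrow> nat \<Rightarrow> ct \<Rightarrow> ct" where
  "hterm e f y t = ind (ev e (CAnd (at_var 2) (CBind 4
     (ev e (CLe (CAdd one (cnt 4 at0)) (cnt 0 (CAnd at01 (CBind 2
       (evalways e (CLe (CAdd one (cnt 0 (flip f)))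
          (CAdd (cnt 4 at0) (cnt 0 (CBind y (holds t)))))))))))))) "

text \<open>Odd numbers avoid the reserved variables 0, 2 and 4, and in binary the map merely adds a
  lowest digit 1.\<close>

definition pvar :: "nat \<Rightarrow> nat" where "pvar x = 2 * x + 1"

primrec tr_term :: "ph_term \<Rightarrow> ct" where
  "tr_term (PConst a) = CConst (int a)"
| "tr_term (PMul a x) = CCount (int a) 0 (before (pvar x))"
| "tr_term (PAdd s t) = CAdd (tr_term s) (tr_term t)"

text \<open>For \<open>PAnd\<close> the threshold is 2 in mode 0 and 1 in mode 1, which is De
  Morgan's law. \<open>PEx\<close> denies that there are exactly 0 witnesses, the bound 0 being the
  count of a false formula.\<close>

primrec tr :: "bool \<Rightarrow> ph \<Rightarrow> ct" where
  "tr e (PLe s t) = ind (evalways e (flip (CLe (tr_term s) (tr_term t))))"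
| "tr e (PNot f) = ind (CNot (holds (tr e f)))"
| "tr e (PAnd f g) = ind (CLe (CAdd one (cnt 2 at0)) (CAdd (tr e f) (tr e g)))"
| "tr e (PEx x f) = ind (CNot (holds (hterm e (CNot true_cf) (pvar x) (tr e f))))"
| "tr e (PHaertig x y f) = hterm e (before (pvar x)) (pvar y) (tr e f)"

section \<open>Semantics of the building blocks\<close>

lemma ks_lab_loop [simp]: "0 \<in> ks_lab loop 0"
  by (simp add: ks_lab_def loop_def)

lemma sat_until: "sat i \<theta> (until e f g) \<longleftrightarrow> sat i \<theta> (CU f g)"
  by (auto simp: until_def is_run_loop)

lemma sat_ev [simp]: "sat i \<theta> (ev e f) \<longleftrightarrow> (\<exists>k\<ge>i. sat k \<theta> f)"
  unfolding ev_def sat_until by auto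

text \<open>The start \<open>i\<close> disappears because a threshold can always be raised above
  it.\<close>

lemma sat_evalways [simp]: "sat i \<theta> (evalways e f) \<longleftrightarrow> (\<forall>\<^sub>F k in at_top. sat k \<theta> f)"
  unfolding evalways_def eventually_at_top_linorder
  by simp (metis le_trans max.cobounded1 max.cobounded2)

lemma val_cnt [simp]: "val i \<theta> (cnt x f) = int (card {j. \<theta> x \<le> j \<and> j \<le> i \<and> sat j \<theta> f})"
  by (simp add: cnt_def)

lemma val_one [simp]: "val i \<theta> one = 1"
  by (simp add: one_def)

text \<open>All position tests rest on this truncated difference: it is 0 exactly before
  \<open>\<theta> x\<close> and 1 exactly at \<open>\<theta> x\<close>.\<close>

lemma val_cnt_top: "val i \<theta> (cnt x true_cf) = int (Suc i - \<theta> x)"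
proof -
  have "{j. \<theta> x \<le> j \<and> j \<le> i \<and> sat j \<theta> true_cf} = {\<theta> x..i}" by auto
  then show ?thesis by simp
qed

declare val_cnt [simp del]

lemma sat_at0 [simp]: "\<theta> 0 = 0 \<Longrightarrow> sat i \<theta> at0 \<longleftrightarrow> i = 0"
  by (auto simp: at0_def val_cnt_top)

lemma sat_at01 [simp]: "\<theta> 0 = 0 \<Longrightarrow> sat i \<theta> at01 \<longleftrightarrow> i \<le> 1"
  by (auto simp: at01_def val_cnt_top)

lemma sat_at_var [simp]: "sat i \<theta> (at_var x) \<longleftrightarrow> i = \<theta> x"
  by (auto simp: at_var_def val_cnt_top)

lemma sat_before [simp]: "sat i \<theta> (before x) \<longleftrightarrow> i < \<theta> x"
  by (auto simp: before_def val_cnt_top)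

lemma sat_holds [simp]: "sat i \<theta> (holds t) \<longleftrightarrow> val i \<theta> t \<ge> 1"
  by (simp add: holds_def)

lemma val_cnt_at0 [simp]: "\<theta> 0 = 0 \<Longrightarrow> val i \<theta> (cnt x at0) = of_bool (\<theta> x = 0)"
proof -
  assume "\<theta> 0 = 0"
  then have "{j. \<theta> x \<le> j \<and> j \<le> i \<and> sat j \<theta> at0} = (if \<theta> x = 0 then {0} else {})" by auto
  then show ?thesis by (simp add: val_cnt)
qed

lemma val_ind [simp]: "\<theta> 0 = 0 \<Longrightarrow> val i \<theta> (ind f) = of_bool (sat 0 \<theta> f)"
proof -
  assume "\<theta> 0 = 0"
  then have "{j. \<theta> 0 \<le> j \<and> j \<le> i \<and> sat j \<theta> (CAnd at0 f)} = (if sat 0 \<theta> f then {0} else {})" by auto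
  then show ?thesis by (simp add: ind_def val_cnt)
qed

lemma sat_flip [simp]: "\<theta> 0 = 0 \<Longrightarrow> sat i \<theta> (flip f) \<longleftrightarrow> (sat i \<theta> f \<longleftrightarrow> \<theta> 2 = 0)"
  by (auto simp: flip_def)

section \<open>Counts at large positions\<close>

lemma val_tr_term:
  assumes "\<theta> 0 = 0"
  shows "\<forall>\<^sub>F k in at_top. val k \<theta> (tr_term s) = int (ph_tval (\<lambda>x. \<theta> (pvar x)) s)"
proof (induction s)
  case (PMul a x)
  have "{j. \<theta> 0 \<le> j \<and> j \<le> k \<and> sat j \<theta> (before (pvar x))} = {..<\<theta> (pvar x)}"
    if "\<theta> (pvar x) \<le> k" for k using that assms by auto
  then show ?case unfolding eventually_at_top_linorder by (auto intro!: exI[of _ "\<theta> (pvar x)"])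
next
  case (PAdd s t)
  then show ?case by (rule eventually_elim2) simp
qed auto

text \<open>The counts of an infinite set exceed every bound, so finiteness is only a premise
  here.\<close>

lemma eventually_card_ge:
  "(\<forall>\<^sub>F k in at_top. n \<le> card {j::nat. j \<le> k \<and> P j}) \<longleftrightarrow> (finite {j. P j} \<longrightarrow> n \<le> card {j. P j})"
proof
  assume ev: "\<forall>\<^sub>F k in at_top. n \<le> card {j::nat. j \<le> k \<and> P j}"
  show "finite {j. P j} \<longrightarrow> n \<le> card {j. P j}"
  proof
    assume fin: "finite {j. P j}"
    obtain k where "n \<le> card {j. j \<le> k \<and> P j}"
      using ev unfolding eventually_at_top_linorder by blast
    also have "\<dots> \<le> card {j. P j}" using fin by (intro card_mono) auto
    finally show "n \<le> card {j. P j}" .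
  qed
next
  assume R: "finite {j. P j} \<longrightarrow> n \<le> card {j. P j}"
  \<comment> \<open>A set of \<open>n\<close> solutions; once \<open>k\<close> passes its maximum,
    the count is at least \<open>n\<close>.\<close>
  obtain A where A: "A \<subseteq> {j. P j}" "finite A" "card A = n"
    using R by (metis infinite_arbitrarily_large obtain_subset_with_card_n)
  obtain m where m: "\<And>j. j \<in> A \<Longrightarrow> j \<le> m"
    using A(2) finite_nat_set_iff_bounded_le by auto
  have "n \<le> card {j. j \<le> k \<and> P j}" if "m \<le> k" for k
    unfolding A(3)[symmetric] using A m that by (intro card_mono) (auto intro: order_trans)
  then show "\<forall>\<^sub>F k in at_top. n \<le> card {j. j \<le> k \<and> P j}"
    unfolding eventually_at_top_linorder by blast
qed

text \<open>If the right side fails, the counts eventually reach \<open>Suc n\<close> by the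
  previous lemma, contradicting the bound at a common large position.\<close>

lemma eventually_card_le:
  "(\<forall>\<^sub>F k in at_top. card {j::nat. j \<le> k \<and> P j} \<le> n) \<longleftrightarrow> finite {j. P j} \<and> card {j. P j} \<le> n"
proof
  assume R: "finite {j. P j} \<and> card {j. P j} \<le> n"
  have "card {j. j \<le> k \<and> P j} \<le> n" for k
    by (rule order_trans[OF card_mono conjunct2[OF R]]) (use R in auto)
  then show "\<forall>\<^sub>F k in at_top. card {j::nat. j \<le> k \<and> P j} \<le> n" by simp
next
  assume ev: "\<forall>\<^sub>F k in at_top. card {j::nat. j \<le> k \<and> P j} \<le> n"
  have False if "finite {j. P j} \<longrightarrow> Suc n \<le> card {j. P j}"
  proof -
    from that have "\<forall>\<^sub>F k in at_top. Suc n \<le> card {j::nat. j \<le> k \<and> P j}"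
      unfolding eventually_card_ge .
    with ev have "\<forall>\<^sub>F k::nat in at_top. False" by (rule eventually_elim2) simp
    then show False by simp
  qed
  then show "finite {j. P j} \<and> card {j. P j} \<le> n" by (meson not_less_eq_eq)
qed

text \<open>Turns an upper bound on a count into a lower bound on the count of the negation.\<close>

lemma card_compl_le: "card {j. j \<le> k \<and> \<not> P j} + card {j::nat. j \<le> k \<and> P j} = Suc k"
proof -
  have "card ({j. j \<le> k \<and> \<not> P j} \<union> {j::nat. j \<le> k \<and> P j}) = Suc k"
    by (rule trans[OF arg_cong[of _ "{..k}" card]]) auto
  then show ?thesis by (subst (asm) card_Un_disjoint) auto
qed

text \<open>The inner mode \<open>b = 0\<close> contributes "at least \<open>n\<close>" and \<open>b = 1\<close> contributes "at most \<open>n\<close>"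
  (both strict if the outer mode \<open>m\<close> is 1). Both must hold if \<open>m = 0\<close>, and one of them if \<open>m = 1\<close>.\<close>

lemma val_hterm:
  assumes \<theta>: "\<theta> 0 = 0" "\<theta> 2 \<le> 1"
    and y: "y \<notin> {0, 2, 4}"
    and f: "\<And>a b j. sat j (\<theta>(4 := a, 2 := b)) f \<longleftrightarrow> j < n"
    and t: "\<And>a b c i. b \<le> 1 \<Longrightarrow> val i (\<theta>(4 := a, 2 := b, y := c)) t = of_bool (P c \<longleftrightarrow> b = 0)"
  shows "val i \<theta> (hterm e f y t) =
    of_bool ((finite {c. P c} \<and> card {c. P c} = n) \<longleftrightarrow> \<theta> 2 = 0)"
proof -
  define m where "m = \<theta> 2"
  define g where
    "g = evalways e (CLe (CAdd one (cnt 0 (flip f))) (CAdd (cnt 4 at0) (cnt 0 (CBind y (holds t)))))"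
  define X where "X b \<longleftrightarrow> sat b (\<theta>(4 := m, 2 := b)) g" for b
  have cy: "val k (\<theta>(4 := m, 2 := b)) (cnt 0 (CBind y (holds t))) = int (card {j. j \<le> k \<and> (P j \<longleftrightarrow> b = 0)})"
    if "b \<le> 1" for b k
    using t[OF that] \<theta>(1) by (auto simp: val_cnt intro!: arg_cong[of _ _ card])
  have cf: "val k (\<theta>(4 := m, 2 := b)) (cnt 0 (flip f)) = int (card {j. j \<le> k \<and> (j < n \<longleftrightarrow> b = 0)})"
    for b k using f \<theta>(1) by (simp add: val_cnt)
  have X: "X b \<longleftrightarrow> (\<forall>\<^sub>F k in at_top. card {j. j \<le> k \<and> (j < n \<longleftrightarrow> b = 0)} + m
       \<le> card {j. j \<le> k \<and> (P j \<longleftrightarrow> b = 0)})" if "b \<le> 1" for b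
  proof -
    have "m = 0 \<or> m = 1" using \<theta>(2) by (auto simp: m_def)
    then have "sat k (\<theta>(4 := m, 2 := b))
        (CLe (CAdd one (cnt 0 (flip f))) (CAdd (cnt 4 at0) (cnt 0 (CBind y (holds t))))) \<longleftrightarrow>
      card {j. j \<le> k \<and> (j < n \<longleftrightarrow> b = 0)} + m \<le> card {j. j \<le> k \<and> (P j \<longleftrightarrow> b = 0)}" for k
      using \<theta>(1) by (simp add: cy[OF that] cf) auto
    then show ?thesis unfolding X_def g_def by simp
  qed
  have ev_n: "\<forall>\<^sub>F k in at_top. card {j. j \<le> k \<and> j < n} = n"
  proof -
    have "{j. j \<le> k \<and> j < n} = {..<n}" if "n \<le> k" for k using that by auto
    then show ?thesis unfolding eventually_at_top_linorder by (auto intro!: exI[of _ n])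
  qed
  have X0: "X 0 \<longleftrightarrow> (finite {j. P j} \<longrightarrow> n + m \<le> card {j. P j})"
  proof -
    have "X 0 \<longleftrightarrow> (\<forall>\<^sub>F k in at_top. n + m \<le> card {j. j \<le> k \<and> P j})"
      by (simp add: X) (rule eventually_cong[OF ev_n], simp)
    then show ?thesis by (simp add: eventually_card_ge)
  qed
  have X1: "X 1 \<longleftrightarrow> (finite {j. P j} \<and> card {j. P j} + m \<le> n)"
  proof -
    have "X 1 \<longleftrightarrow> (\<forall>\<^sub>F k in at_top. card {j. j \<le> k \<and> P j} + m \<le> n)"
    proof -
      \<comment> \<open>Both complements are taken within \<open>{..k}\<close>, so comparing them
        reverses the comparison of the counts.\<close>
      have "card {j. j \<le> k \<and> \<not> j < n} + m \<le> card {j. j \<le> k \<and> \<not> P j} \<longleftrightarrow>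
         card {j. j \<le> k \<and> P j} + m \<le> n" if "card {j. j \<le> k \<and> j < n} = n" for k
        using card_compl_le[of k P] card_compl_le[of k "\<lambda>j. j < n"] that by linarith
      then show ?thesis by (simp add: X del: not_less) (rule eventually_cong[OF ev_n], simp)
    qed
    also have "\<dots> \<longleftrightarrow> (finite {j. P j} \<and> card {j. P j} + m \<le> n)"
    \<comment> \<open>If \<open>m\<close> exceeds \<open>n\<close>, both sides are false; otherwise
      \<open>n - m\<close> is a genuine difference.\<close>
    proof (cases "m \<le> n")
      case True
      then have "x + m \<le> n \<longleftrightarrow> x \<le> n - m" for x by linarith
      then show ?thesis by (simp add: eventually_card_le)
    qed simp
    finally show ?thesis .
  qed
  have "val i \<theta> (hterm e f y t) = of_bool (\<exists>k\<ge>m. 1 + of_bool (m = 0) \<le> int (card {b. b \<le> k \<and> b \<le> 1 \<and> X b}))"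
    using \<theta> unfolding hterm_def g_def[symmetric] by (simp add: val_cnt[where f = "CAnd at01 h" for h] m_def X_def)
  also have "(\<exists>k\<ge>m. 1 + of_bool (m = 0) \<le> int (card {b. b \<le> k \<and> b \<le> 1 \<and> X b})) \<longleftrightarrow>
     1 + of_bool (m = 0) \<le> int (card {b. b \<le> 1 \<and> X b})"
  proof
    assume "\<exists>k\<ge>m. 1 + of_bool (m = 0) \<le> int (card {b. b \<le> k \<and> b \<le> 1 \<and> X b})"
    then obtain k where "1 + of_bool (m = 0) \<le> int (card {b. b \<le> k \<and> b \<le> 1 \<and> X b})" by blast
    also have "\<dots> \<le> int (card {b. b \<le> 1 \<and> X b})" by (auto intro!: card_mono)
    finally show "1 + of_bool (m = 0) \<le> int (card {b. b \<le> 1 \<and> X b})" .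
  next
    assume "1 + of_bool (m = 0) \<le> int (card {b. b \<le> 1 \<and> X b})"
    moreover have "{b. b \<le> 1 \<and> b \<le> 1 \<and> X b} = {b. b \<le> 1 \<and> X b}" by auto
    moreover have "m \<le> 1" using \<theta>(2) m_def by simp
    ultimately show "\<exists>k\<ge>m. 1 + of_bool (m = 0) \<le> int (card {b. b \<le> k \<and> b \<le> 1 \<and> X b})"
      \<comment> \<open>Position 1 is not before \<open>m\<close> and already counts both inner
        modes.\<close>
      by (intro exI[of _ 1]) simp
  qed
  also have "{b. b \<le> 1 \<and> X b} = (if X 0 then {0} else {}) \<union> (if X 1 then {1} else {})"
  proof -
    have le1: "b \<le> 1 \<longleftrightarrow> b = 0 \<or> b = 1" for b :: nat by auto
    show ?thesis by (simp only: le1 conj_disj_distribR Collect_disj_eq Collect_conv_if)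
  qed
  also have "(1 + of_bool (m = 0) \<le> int (card \<dots>)) \<longleftrightarrow> ((finite {c. P c} \<and> card {c. P c} = n) \<longleftrightarrow> m = 0)"
  proof -
    have "m = 0 \<or> m = 1" using \<theta>(2) by (auto simp: m_def)
    then show ?thesis by (auto simp: X0 X1[unfolded One_nat_def])
  qed
  finally show ?thesis by (simp add: m_def)
qed

section \<open>Correctness of the translation\<close>

lemma pvar_simps [simp]: "pvar x \<noteq> 0" "pvar x \<noteq> 2" "pvar x \<noteq> 4" "pvar x = pvar y \<longleftrightarrow> x = y"
  unfolding pvar_def by presburger+

text \<open>Both \<open>\<theta>\<close> and \<open>i\<close> vary in the induction: the quantifier
  cases evaluate the subformula under both modes, for every value of the bound variable and at every
  counted position.\<close>

lemma val_tr:
  "\<theta> 0 = 0 \<Longrightarrow> \<theta> 2 \<le> 1 \<Longrightarrow>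
     val i \<theta> (tr e f) = of_bool (ph_sat (\<lambda>x. \<theta> (pvar x)) f \<longleftrightarrow> \<theta> 2 = 0)"
proof (induction f arbitrary: i \<theta>)
  case (PLe s t)
  have "\<forall>\<^sub>F k in at_top. sat k \<theta> (flip (CLe (tr_term s) (tr_term t))) \<longleftrightarrow>
      (ph_sat (\<lambda>x. \<theta> (pvar x)) (PLe s t) \<longleftrightarrow> \<theta> 2 = 0)"
    using val_tr_term[of \<theta> s, OF PLe(1)] val_tr_term[of \<theta> t, OF PLe(1)]
    by (rule eventually_elim2) (simp add: PLe)
  then have "(\<forall>\<^sub>F k in at_top. sat k \<theta> (flip (CLe (tr_term s) (tr_term t)))) \<longleftrightarrow>
      (\<forall>\<^sub>F k::nat in at_top. (ph_sat (\<lambda>x. \<theta> (pvar x)) (PLe s t) \<longleftrightarrow> \<theta> 2 = 0))"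
    by (rule eventually_cong) simp
  then show ?case using PLe by simp
next
  case (PNot f)
  then show ?case by auto
next
  case (PAnd f g)
  then show ?case by auto
next
  case (PEx x f)
  have e: "(\<lambda>z. (\<theta>(4 := a, 2 := b, pvar x := c)) (pvar z)) = (\<lambda>z. \<theta> (pvar z))(x := c)" for a b c
    by auto
  have "val i \<theta> (hterm e (CNot true_cf) (pvar x) (tr e f)) =
     of_bool ((finite {c. ph_sat ((\<lambda>z. \<theta> (pvar z))(x := c)) f} \<and>
               card {c. ph_sat ((\<lambda>z. \<theta> (pvar z))(x := c)) f} = 0) \<longleftrightarrow> \<theta> 2 = 0)" for i
  proof (rule val_hterm)
    fix a b c i assume "b \<le> (1::nat)"
    then have p: "(\<theta>(4 := a, 2 := b, pvar x := c)) 0 = 0" "(\<theta>(4 := a, 2 := b, pvar x := c)) 2 \<le> 1"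
      and b: "(\<theta>(4 := a, 2 := b, pvar x := c)) 2 = b" using PEx.prems by simp_all
    show "val i (\<theta>(4 := a, 2 := b, pvar x := c)) (tr e f) =
        of_bool (ph_sat ((\<lambda>z. \<theta> (pvar z))(x := c)) f \<longleftrightarrow> b = 0)"
      using PEx.IH[OF p] unfolding e b .
  qed (use PEx.prems in auto)
  \<comment> \<open>Finiteness matters, since \<open>card\<close> is also 0 on infinite
    sets.\<close>
  moreover have "finite S \<and> card S = 0 \<longleftrightarrow> S = {}" for S :: "nat set" by auto
  ultimately show ?case using PEx.prems by auto
next
  case (PHaertig x y f)
  have e: "(\<lambda>z. (\<theta>(4 := a, 2 := b, pvar y := c)) (pvar z)) = (\<lambda>z. \<theta> (pvar z))(y := c)" for a b c
    by auto
  show ?case unfolding tr.simps ph_sat.simps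
  proof (rule val_hterm)
    fix a b c i assume "b \<le> (1::nat)"
    then have p: "(\<theta>(4 := a, 2 := b, pvar y := c)) 0 = 0" "(\<theta>(4 := a, 2 := b, pvar y := c)) 2 \<le> 1"
      and b: "(\<theta>(4 := a, 2 := b, pvar y := c)) 2 = b" using PHaertig.prems by simp_all
    show "val i (\<theta>(4 := a, 2 := b, pvar y := c)) (tr e f) =
        of_bool (ph_sat ((\<lambda>z. \<theta> (pvar z))(y := c)) f \<longleftrightarrow> b = 0)"
      using PHaertig.IH[OF p] unfolding e b .
  qed (use PHaertig.prems in auto)
qed

text \<open>The closure quantifies over coefficients as if they were variables, too: this is harmless and
  spares the transducer from telling them apart.\<close>

primrec nums_term :: "ph_term \<Rightarrow> nat list" where
  "nums_term (PConst a) = [a]"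
| "nums_term (PMul a x) = [a, x]"
| "nums_term (PAdd s t) = nums_term s @ nums_term t"

primrec nums :: "ph \<Rightarrow> nat list" where
  "nums (PLe s t) = nums_term s @ nums_term t"
| "nums (PNot f) = nums f"
| "nums (PAnd f g) = nums f @ nums g"
| "nums (PEx x f) = x # nums f"
| "nums (PHaertig x y f) = x # y # nums f"

lemma ph_tval_cong: "\<forall>x\<in>set (nums_term s). \<eta> x = \<eta>' x \<Longrightarrow> ph_tval \<eta> s = ph_tval \<eta>' s"
  by (induction s) auto

lemma ph_sat_cong: "\<forall>x\<in>set (nums f). \<eta> x = \<eta>' x \<Longrightarrow> ph_sat \<eta> f \<longleftrightarrow> ph_sat \<eta>' f"
proof (induction f arbitrary: \<eta> \<eta>')
  case (PLe s t)
  then show ?case using ph_tval_cong[of s \<eta> \<eta>'] ph_tval_cong[of t \<eta> \<eta>'] by simp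
next
  case (PEx x f)
  then have "ph_sat (\<eta>(x := b)) f \<longleftrightarrow> ph_sat (\<eta>'(x := b)) f" for b by (intro PEx.IH) auto
  then show ?case by simp
next
  case (PHaertig x y f)
  then have "ph_sat (\<eta>(y := b)) f \<longleftrightarrow> ph_sat (\<eta>'(y := b)) f" for b by (intro PHaertig.IH) auto
  then show ?case using PHaertig.prems by simp
next
  case (PNot f)
  then show ?case using PNot.IH[of \<eta> \<eta>'] by simp
next
  case (PAnd f g)
  show ?case using PAnd.IH[of \<eta> \<eta>'] PAnd.prems by (simp add: ball_Un)
qed

lemma ph_sat_foldr_PEx:
  "ph_sat \<eta> (foldr PEx xs f) \<longleftrightarrow> (\<exists>\<eta>'. (\<forall>x. x \<notin> set xs \<longrightarrow> \<eta>' x = \<eta> x) \<and> ph_sat \<eta>' f)"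
proof (induction xs arbitrary: \<eta>)
  case Nil
  have "\<eta>' = \<eta>" if "\<forall>x. \<eta>' x = \<eta> x" for \<eta>' using that by auto
  then show ?case by auto
next
  case (Cons y xs)
  show ?case
  proof
    assume "ph_sat \<eta> (foldr PEx (y # xs) f)"
    then obtain b where "ph_sat (\<eta>(y := b)) (foldr PEx xs f)" by auto
    then obtain \<eta>' where "\<forall>x. x \<notin> set xs \<longrightarrow> \<eta>' x = (\<eta>(y := b)) x" "ph_sat \<eta>' f"
      unfolding Cons.IH by blast
    then show "\<exists>\<eta>'. (\<forall>x. x \<notin> set (y # xs) \<longrightarrow> \<eta>' x = \<eta> x) \<and> ph_sat \<eta>' f"
      by (intro exI[of _ \<eta>']) auto
  next
    assume "\<exists>\<eta>'. (\<forall>x. x \<notin> set (y # xs) \<longrightarrow> \<eta>' x = \<eta> x) \<and> ph_sat \<eta>' f"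
    then obtain \<eta>' where "\<forall>x. x \<notin> set (y # xs) \<longrightarrow> \<eta>' x = \<eta> x" "ph_sat \<eta>' f" by blast
    then have "ph_sat (\<eta>(y := \<eta>' y)) (foldr PEx xs f)" unfolding Cons.IH by auto
    then show "ph_sat \<eta> (foldr PEx (y # xs) f)" by auto
  qed
qed

section \<open>The reduction and its correctness\<close>

definition reduct :: "bool \<Rightarrow> ph \<Rightarrow> kripke \<times> cf" where
  "reduct e f = (loop, holds (tr e (foldr PEx (nums f) f)))"

text \<open>\<open>models\<close> starts from the valuation 0, which sets the mode to 0, so the
  closure is read unnegated; the closure replaces the choice of a valuation.\<close>

lemma reduct_correct: "ph_satisfiable f \<longleftrightarrow> models (fst (reduct e f)) (snd (reduct e f))"
proof -
  have "models (fst (reduct e f)) (snd (reduct e f)) \<longleftrightarrow> ph_sat (\<lambda>_. 0) (foldr PEx (nums f) f)"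
    by (auto simp: models_def reduct_def is_run_loop val_tr) (simp add: loop_def)
  also have "\<dots> \<longleftrightarrow> ph_satisfiable f"
  proof
    assume "ph_satisfiable f"
    then obtain \<eta> where \<eta>: "ph_sat \<eta> f" by (auto simp: ph_satisfiable_def)
    \<comment> \<open>Outside \<open>nums f\<close> the valuation must stay 0, as the closure
      changes nothing else.\<close>
    have "ph_sat (\<lambda>x. if x \<in> set (nums f) then \<eta> x else 0) f"
      using \<eta> by (subst ph_sat_cong[of _ _ \<eta>]) auto
    then show "ph_sat (\<lambda>_. 0) (foldr PEx (nums f) f)"
      unfolding ph_sat_foldr_PEx
      by (intro exI[of _ "\<lambda>x. if x \<in> set (nums f) then \<eta> x else 0"]) simp
  qed (auto simp: ph_sat_foldr_PEx ph_satisfiable_def)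
  finally show ?thesis by simp
qed

lemmas template_defs = hterm_def flip_def evalways_def ev_def until_def ind_def holds_def cnt_def
  one_def at0_def at01_def at_var_def before_def

lemma is_cltl_reduct: "is_cltl (snd (reduct False f))"
proof -
  have t: "is_cltl_t (tr_term s)" for s by (induction s) (auto simp: template_defs)
  have "is_cltl_t (tr False g)" for g by (induction g) (auto simp: template_defs t)
  then show ?thesis by (auto simp: reduct_def template_defs)
qed

lemma is_cctl_reduct: "is_cctl (snd (reduct True f))"
proof -
  have t: "is_cctl_t (tr_term s)" for s by (induction s) (auto simp: template_defs)
  have "is_cctl_t (tr True g)" for g by (induction g) (auto simp: template_defs t)
  then show ?thesis by (auto simp: reduct_def template_defs)
qed

section \<open>The reduction as a transducer\<close>

declare bits.simps [simp del]

section \<open>Symbols occurring in encodings\<close>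

lemma set_bits: "set (bits n) \<subseteq> {1, 2}"
proof (induction n rule: bits.induct)
  case (1 n)
  then show ?case by (subst bits.simps) auto
qed

lemma enc_nat_symbols: "set (enc_nat n) \<subseteq> {1..3}"
  using set_bits[of n] by (auto simp: enc_nat_def)

lemma enc_int_symbols: "set (enc_int a) \<subseteq> {1..5}"
  using enc_nat_symbols[of "nat \<bar>a\<bar>"] by (fastforce simp: enc_int_def)

lemma enc_ph_symbols: "set (enc_ph f) \<subseteq> {1..27}"
proof -
  have n: "set (enc_nat n) \<subseteq> {1..27}" for n using enc_nat_symbols[of n] by fastforce
  have t: "set (enc_pht s) \<subseteq> {1..27}" for s using n by (induction s) auto
  show ?thesis using n t by (induction f) auto
qed

lemma enc_cf_symbols: "set (enc_cf f) \<subseteq> {1..27}" "set (enc_ct t) \<subseteq> {1..27}"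
proof (induction f and t)
  case (Prop p)
  then show ?case using enc_nat_symbols[of p] by fastforce
next
  case (CBind x f)
  then show ?case using enc_nat_symbols[of x] by fastforce
next
  case (CConst a)
  then show ?case using enc_int_symbols[of a] by fastforce
next
  case (CCount a x f)
  then show ?case using enc_int_symbols[of a] enc_nat_symbols[of x] by fastforce
qed auto

text \<open>Digits are written lowest first and the symbol 2 stands for the digit 1.\<close>

lemma enc_nat_pvar: "enc_nat (pvar x) = 2 # enc_nat x"
  unfolding enc_nat_def pvar_def by (subst bits.simps) simp

lemma enc_int_of_nat: "enc_int (int a) = 5 # enc_nat a"
  by (simp add: enc_int_def)

text \<open>The suffix P marks the part of an encoding before the argument of a construct, A and B the parts
  before its first and after its first argument.\<close>

definition "evP e = (if e then [21] else []) @ 20 # enc_cf true_cf"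
definition "evaP e = evP e @ 18 # evP e @ [18]"
definition "cntP x = 25 # enc_int 1 @ enc_nat x"
definition "indP = cntP 0 @ 17 # enc_cf at0"
definition "holdsP = 23 # enc_ct one"
definition "flipA = 17 # 18 # 17 # enc_cf (holds (cnt 2 at0)) @ [18]"
definition "flipB = 18 # 17 # 18 # enc_cf (holds (cnt 2 at0))"
text \<open>The final 2 is the lowest digit of \<open>pvar x\<close>, so that the digits of
  \<open>x\<close> can be copied unchanged; \<open>htermB\<close> ends in the same way.\<close>

definition "beforeA = 23 # 25 # enc_int 1 @ [2]"
definition "beforeB = enc_cf true_cf @ enc_ct (CConst 0)"
definition "leP e = indP @ evaP e @ flipA @ [23]"
definition "notP = indP @ 18 # holdsP"
definition "andP = indP @ 23 # enc_ct (CAdd one (cnt 2 at0)) @ [26]"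
definition "htermA e = indP @ evP e @ 17 # enc_cf (at_var 2) @ 22 # enc_nat 4 @ evP e @
  23 # enc_ct (CAdd one (cnt 4 at0)) @ cntP 0 @ 17 # enc_cf at01 @ 22 # enc_nat 2 @ evaP e @
  23 # 26 # enc_ct one @ cntP 0"
definition "htermB = 26 # enc_ct (cnt 4 at0) @ cntP 0 @ [22, 2]"
definition "exP e = notP @ htermA e @ enc_cf (flip (CNot true_cf)) @ htermB"

section \<open>Encodings of the translated formulae\<close>

lemma enc_ev: "enc_cf (ev e f) = evP e @ enc_cf f"
  by (simp add: ev_def until_def evP_def)

lemma enc_evalways: "enc_cf (evalways e f) = evaP e @ enc_cf f"
  by (simp add: evalways_def evaP_def enc_ev)

lemma enc_cnt: "enc_ct (cnt x f) = cntP x @ enc_cf f"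
  by (simp add: cnt_def cntP_def)

lemma enc_ind: "enc_ct (ind f) = indP @ enc_cf f"
  by (simp add: ind_def indP_def enc_cnt)

lemma enc_holds: "enc_cf (holds t) = holdsP @ enc_ct t"
  by (simp add: holds_def holdsP_def)

lemma enc_flip: "enc_cf (flip f) = flipA @ enc_cf f @ flipB @ enc_cf f"
  by (simp add: flip_def flipA_def flipB_def)

lemma enc_before: "enc_cf (before (pvar x)) = beforeA @ enc_nat x @ beforeB"
  by (simp add: before_def beforeA_def beforeB_def cnt_def enc_nat_pvar)

lemma enc_hterm:
  "enc_ct (hterm e f (pvar y) t) = htermA e @ enc_cf (flip f) @ htermB @ enc_nat y @ holdsP @ enc_ct t"
  by (simp add: hterm_def htermA_def htermB_def enc_ind enc_ev enc_evalways enc_cnt enc_holds enc_nat_pvar)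

lemma enc_tr_term:
  "enc_ct (tr_term (PConst a)) = 24 # 5 # enc_nat a"
  "enc_ct (tr_term (PMul a x)) = 25 # 5 # enc_nat a @ enc_nat 0 @ beforeA @ enc_nat x @ beforeB"
  "enc_ct (tr_term (PAdd s t)) = 26 # enc_ct (tr_term s) @ enc_ct (tr_term t)"
  by (simp_all add: enc_before enc_int_of_nat)

lemma enc_tr:
  "enc_ct (tr e (PLe s t)) = leP e @ enc_ct (tr_term s) @ enc_ct (tr_term t) @
     flipB @ 23 # enc_ct (tr_term s) @ enc_ct (tr_term t)"
  "enc_ct (tr e (PNot f)) = notP @ enc_ct (tr e f)"
  "enc_ct (tr e (PAnd f g)) = andP @ enc_ct (tr e f) @ enc_ct (tr e g)"
  "enc_ct (tr e (PEx x f)) = exP e @ enc_nat x @ holdsP @ enc_ct (tr e f)"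
  "enc_ct (tr e (PHaertig x y f)) = htermA e @ flipA @ beforeA @ enc_nat x @ beforeB @
     flipB @ beforeA @ enc_nat x @ beforeB @ htermB @ enc_nat y @ holdsP @ enc_ct (tr e f)"
  by (simp_all add: leP_def notP_def andP_def exP_def enc_ind enc_evalways enc_holds enc_hterm
      enc_flip enc_before)

lemma enc_reduct:
  "enc_inst (reduct e f) = enc_kripke loop @ holdsP @
     concat (map (\<lambda>x. exP e @ enc_nat x @ holdsP) (nums f)) @ enc_ct (tr e f)"
proof -
  have "enc_ct (tr e (foldr PEx xs f)) =
    concat (map (\<lambda>x. exP e @ enc_nat x @ holdsP) xs) @ enc_ct (tr e f)" for xs
    by (induction xs) (simp_all add: enc_tr del: tr.simps)
  then show ?thesis by (simp add: enc_inst_def reduct_def enc_holds)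
qed

text \<open>\<open>Close\<close> emits the existential closure in a first sweep, and \<open>Main\<close> the formula in a second one.
  The flag of a state tells whether the first or the second copy of a comparison, or of the counting
  variable of a Haertig quantifier, is emitted; in between, the head returns to the tag.\<close>

datatype state = Start | Close | CloseNum | Rewind | Main | BoundNum
  | Haertig bool | HaertigBack | Term bool | Coeff bool | Var bool | TermBack

instance state :: finite
proof
  have "q \<in> {Start, Close, CloseNum, Rewind, Main, BoundNum, HaertigBack, TermBack}
     \<union> range Haertig \<union> range Term \<union> range Coeff \<union> range Var" for q
    by (cases q) auto
  then have "(UNIV :: state set) \<subseteq> {Start, Close, CloseNum, Rewind, Main, BoundNum, HaertigBack, TermBack}
     \<union> range Haertig \<union> range Term \<union> range Coeff \<union> range Var" by blast
  then show "finite (UNIV :: state set)" by (rule finite_subset) simp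
qed

definition copy :: "state \<Rightarrow> state \<Rightarrow> nat list \<Rightarrow> dir \<Rightarrow> nat \<Rightarrow> (state \<times> nat list \<times> dir) option" where
  "copy q q' u d a = (if a = 3 then Some (q', 3 # u, d) else if a \<in> {1, 2} then Some (q, [a], Rgt) else None)"

definition rewind :: "nat \<Rightarrow> state \<Rightarrow> state \<Rightarrow> nat list \<Rightarrow> nat \<Rightarrow> (state \<times> nat list \<times> dir) option" where
  "rewind z q q' u a = (if a = z then Some (q', u, Rgt) else if a = 0 then None else Some (q, [], Lft))"

text \<open>A 3 met in \<open>Close\<close> is the number 0, which has no digits. In
  \<open>Term\<close>, the end of a comparison shows only in the next formula tag or in the marker
  28.\<close>

fun transduce :: "bool \<Rightarrow> state transducer" where
  "transduce e Start a = (if a = 0 then Some (Close, enc_kripke loop @ holdsP, Rgt) else None)"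
| "transduce e Close a =
     (if a = 28 then Some (Rewind, [], Stay) else if a = 3 then Some (Close, exP e @ 3 # holdsP, Rgt)
      else if a \<in> {1, 2} then Some (CloseNum, exP e @ [a], Rgt) else Some (Close, [], Rgt))"
| "transduce e CloseNum a = copy CloseNum Close holdsP Rgt a"
| "transduce e Rewind a = rewind 0 Rewind Main [] a"
| "transduce e Main a =
     (if a = 11 then Some (Term False, leP e, Rgt) else if a = 12 then Some (Main, notP, Rgt)
      else if a = 13 then Some (Main, andP, Rgt) else if a = 14 then Some (BoundNum, exP e, Rgt)
      else if a = 15 then Some (Haertig False, htermA e @ flipA @ beforeA, Rgt) else None)"
| "transduce e BoundNum a = copy BoundNum Main holdsP Rgt a"
| "transduce e (Haertig False) a = copy (Haertig False) HaertigBack (beforeB @ flipB @ beforeA) Stay a"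
| "transduce e HaertigBack a = rewind 15 HaertigBack (Haertig True) [] a"
| "transduce e (Haertig True) a = copy (Haertig True) BoundNum (beforeB @ htermB) Rgt a"
| "transduce e (Term c) a =
     (if a \<in> {1, 2, 3} then Some (Term c, [a], Rgt) else if a = 8 then Some (Term c, [24, 5], Rgt)
      else if a = 9 then Some (Coeff c, [25, 5], Rgt) else if a = 10 then Some (Term c, [26], Rgt)
      else if a = 0 then None else if c then Some (Main, [], Stay) else Some (TermBack, [], Lft))"
| "transduce e (Coeff c) a = copy (Coeff c) (Var c) (enc_nat 0 @ beforeA) Rgt a"
| "transduce e (Var c) a = copy (Var c) (Term c) beforeB Rgt a"
| "transduce e TermBack a = rewind 11 TermBack (Term True) (flipB @ [23]) a"

lemma word_symbols:
  "set holdsP \<subseteq> {1..27}" "set notP \<subseteq> {1..27}" "set andP \<subseteq> {1..27}" "set (exP e) \<subseteq> {1..27}"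
  "set (leP e) \<subseteq> {1..27}" "set (htermA e) \<subseteq> {1..27}" "set htermB \<subseteq> {1..27}"
  "set flipA \<subseteq> {1..27}" "set flipB \<subseteq> {1..27}" "set beforeA \<subseteq> {1..27}" "set beforeB \<subseteq> {1..27}"
  "set (enc_kripke loop) \<subseteq> {1..27}" "set (enc_nat n) \<subseteq> {1..27}"
proof -
  have n: "set (enc_nat n) \<subseteq> {1..27}" for n using enc_nat_symbols[of n] by fastforce
  have i: "set (enc_int n) \<subseteq> {1..27}" for n using enc_int_symbols[of n] by fastforce
  note c = enc_cf_symbols
  note [simp] = n[unfolded One_nat_def] i[unfolded One_nat_def] c[unfolded One_nat_def]
  show "set (enc_nat n) \<subseteq> {1..27}" by (rule n)
  show "set (enc_kripke loop) \<subseteq> {1..27}"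
    by (simp add: enc_kripke_def loop_def enc_list_def)
  show "set holdsP \<subseteq> {1..27}" "set flipA \<subseteq> {1..27}" "set flipB \<subseteq> {1..27}"
    "set beforeA \<subseteq> {1..27}" "set beforeB \<subseteq> {1..27}"
    by (simp_all add: holdsP_def flipA_def flipB_def beforeA_def beforeB_def del: enc_cf.simps enc_ct.simps)
  have v: "set (evP e) \<subseteq> {1..27}" "set indP \<subseteq> {1..27}" "set (cntP n) \<subseteq> {1..27}" for n
    by (auto simp: evP_def indP_def cntP_def simp del: enc_cf.simps enc_ct.simps)
  have w: "set (evaP e) \<subseteq> {1..27}" by (simp add: evaP_def v[unfolded One_nat_def])
  show h: "set htermB \<subseteq> {1..27}" "set (htermA e) \<subseteq> {1..27}" "set notP \<subseteq> {1..27}"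
    and "set andP \<subseteq> {1..27}" and "set (leP e) \<subseteq> {1..27}"
    using \<open>set holdsP \<subseteq> {1..27}\<close> \<open>set flipA \<subseteq> {1..27}\<close>
    by (simp_all add: htermB_def htermA_def notP_def andP_def leP_def v[unfolded One_nat_def] w[unfolded One_nat_def] del: enc_cf.simps enc_ct.simps)
  show "set (exP e) \<subseteq> {1..27}" using h by (simp add: exP_def del: enc_cf.simps enc_ct.simps)
qed

text \<open>A crude bound: an output word uses each of these pieces at most once, and the 5 covers
  single symbols.\<close>

definition "bound e = length holdsP + length notP + length andP + length (exP e) + length (leP e)
  + length (htermA e) + length htermB + length flipA + length flipB + length beforeA + length beforeB
  + length (enc_kripke loop) + length (enc_nat 0) + 5"

interpretation two_way "transduce e" Start "bound e" for e
proof
  fix q q' :: state and a u d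
  show "length u \<le> bound e \<and> set u \<subseteq> {1..27}" if "transduce e q a = Some (q', u, d)"
    using that
    by (cases "(e, q, a)" rule: transduce.cases)
      (auto simp: bound_def copy_def rewind_def subset_iff
        dest!: word_symbols[THEN subsetD] split: if_splits)
  show "d \<noteq> Lft" if "transduce e q 0 = Some (q', u, d)"
    using that by (cases "(e, q, 0::nat)" rule: transduce.cases) (auto simp: copy_def rewind_def split: if_splits)
  show "d \<noteq> Rgt" if "transduce e q 28 = Some (q', u, d)"
    using that by (cases "(e, q, 28::nat)" rule: transduce.cases) (auto simp: copy_def rewind_def split: if_splits)
qed

section \<open>Runs that copy and rewind\<close>

lemma reach_dstep:
  assumes "\<delta> q a = Some (q', u, d)" "move d ls (a # rs) = (ls', rs')"
    and "reach (dstep \<delta>) n (q', ls', rs', out @ u) c"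
  shows "reach (dstep \<delta>) (Suc n) (q, ls, a # rs, out) c"
  using assms by (intro reach_step[of "dstep \<delta>"]) (auto simp: dstep_def head_sym_def)

lemma reach_copy_bits:
  assumes "\<And>a. \<delta> q a = copy q q' u d a" "set w \<subseteq> {1, 2}"
  shows "reach (dstep \<delta>) (length w) (q, ls, w @ rs, out) (q, rev w @ ls, rs, out @ w)"
  using assms(2)
proof (induction w arbitrary: ls out)
  case Nil
  show ?case by (simp add: reach_refl)
next
  case (Cons a w)
  have "reach (dstep \<delta>) (length w) (q, a # ls, w @ rs, out @ [a]) (q, rev w @ a # ls, rs, (out @ [a]) @ w)"
    using Cons.IH[of "a # ls" "out @ [a]"] Cons.prems by simp
  from reach_dstep[OF _ _ this, of q a Rgt ls "w @ rs"] show ?case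
    using Cons.prems assms(1) by (auto simp: copy_def)
qed

text \<open>The hypothesis on \<open>move\<close> serves two uses: \<open>Rgt\<close> passes the
  terminator, while \<open>Stay\<close> rests on it before the number is read again.\<close>

lemma reach_copy:
  assumes \<delta>: "\<And>a. \<delta> q a = copy q q' u d a"
    and m: "move d (rev (bits n) @ ls) (3 # rs) = (ls', rs')"
  shows "reach (dstep \<delta>) (length (enc_nat n)) (q, ls, enc_nat n @ rs, out) (q', ls', rs', out @ enc_nat n @ u)"
proof -
  have 1: "reach (dstep \<delta>) (length (bits n)) (q, ls, bits n @ 3 # rs, out)
     (q, rev (bits n) @ ls, 3 # rs, out @ bits n)"
    by (rule reach_copy_bits, rule \<delta>, rule set_bits)
  have 2: "reach (dstep \<delta>) (Suc 0) (q, rev (bits n) @ ls, 3 # rs, out @ bits n)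
     (q', ls', rs', (out @ bits n) @ 3 # u)"
    by (rule reach_dstep[OF _ m reach_refl]) (simp add: \<delta> copy_def)
  from reach_trans[OF 1 2] show ?thesis by (simp add: enc_nat_def)
qed

text \<open>The head stops at the nearest \<open>z\<close> on its left, and no other 0 may lie on
  the way.\<close>

lemma reach_rewind:
  assumes \<delta>: "\<And>a. \<delta> q a = rewind z q q' u a" and "set (r # w) \<inter> {0, z} = {}"
  shows "reach (dstep \<delta>) (length w + 2) (q, w @ z # ls, r # rs, out)
     (q', z # ls, rev w @ r # rs, out @ u)"
  using assms(2)
proof (induction w arbitrary: r rs)
  case Nil
  have "reach (dstep \<delta>) (Suc (Suc 0)) (q, z # ls, r # rs, out) (q', z # ls, r # rs, (out @ []) @ u)"
    using Nil by (intro reach_dstep[OF _ _ reach_dstep[OF _ _ reach_refl]]) (auto simp: \<delta> rewind_def)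
  then show ?case by (simp add: numeral_2_eq_2)
next
  case (Cons a w)
  from Cons have "reach (dstep \<delta>) (length w + 2) (q, w @ z # ls, a # r # rs, out @ [])
     (q', z # ls, rev w @ a # r # rs, out @ u)" by simp
  from reach_dstep[OF _ _ this, of q r Lft "a # w @ z # ls" rs] show ?case
    using Cons.prems by (simp add: \<delta> rewind_def)
qed

section \<open>The sweep that emits the formula\<close>

lemma reach_term:
  "reach (dstep (transduce e)) (length (enc_pht s)) (Term c, ls, enc_pht s @ rs, out)
     (Term c, rev (enc_pht s) @ ls, rs, out @ enc_ct (tr_term s))"
proof (induction s arbitrary: ls rs out)
  case (PConst a)
  have "reach (dstep (transduce e)) (length w) (Term c, ls, w @ rs, out) (Term c, rev w @ ls, rs, out @ w)"
    if "set w \<subseteq> {1, 2, 3}" for w ls out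
    using that
  proof (induction w arbitrary: ls out)
    case Nil
    show ?case by (simp add: reach_refl)
  next
    case (Cons a w)
    have "reach (dstep (transduce e)) (length w) (Term c, a # ls, w @ rs, out @ [a])
       (Term c, rev w @ a # ls, rs, (out @ [a]) @ w)"
      using Cons.IH[of "a # ls" "out @ [a]"] Cons.prems by simp
    from reach_dstep[OF _ _ this, of "Term c" a Rgt ls "w @ rs"] show ?case
      using Cons.prems by auto
  qed
  moreover have "set (enc_nat a) \<subseteq> {1, 2, 3}" using set_bits[of a] by (auto simp: enc_nat_def)
  ultimately have "reach (dstep (transduce e)) (length (enc_nat a)) (Term c, 8 # ls, enc_nat a @ rs, out @ [24, 5])
     (Term c, rev (enc_nat a) @ 8 # ls, rs, (out @ [24, 5]) @ enc_nat a)" by blast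
  from reach_dstep[OF _ _ this, of "Term c" 8 Rgt ls "enc_nat a @ rs"] show ?case
    unfolding enc_tr_term by simp
next
  case (PMul a x)
  have 1: "reach (dstep (transduce e)) (length (enc_nat a)) (Coeff c, 9 # ls, enc_nat a @ enc_nat x @ rs, out @ [25, 5])
     (Var c, rev (enc_nat a) @ 9 # ls, enc_nat x @ rs, (out @ [25, 5]) @ enc_nat a @ enc_nat 0 @ beforeA)"
    by (rule reach_copy[where d = Rgt]) (simp_all add: enc_nat_def)
  have 2: "reach (dstep (transduce e)) (length (enc_nat x)) (Var c, rev (enc_nat a) @ 9 # ls, enc_nat x @ rs,
       (out @ [25, 5]) @ enc_nat a @ enc_nat 0 @ beforeA)
     (Term c, rev (enc_nat x) @ rev (enc_nat a) @ 9 # ls, rs,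
       ((out @ [25, 5]) @ enc_nat a @ enc_nat 0 @ beforeA) @ enc_nat x @ beforeB)"
    by (rule reach_copy[where d = Rgt]) (simp_all add: enc_nat_def)
  from reach_dstep[OF _ _ reach_trans[OF 1 2], of "Term c" 9 Rgt ls "enc_nat a @ enc_nat x @ rs"] show ?case
    unfolding enc_tr_term by simp
next
  case (PAdd s t)
  from reach_dstep[OF _ _ reach_trans[OF PAdd.IH(1)[of "10 # ls" "enc_pht t @ rs" "out @ [26]"] PAdd.IH(2)],
      of "Term c" 10 Rgt ls "enc_pht s @ enc_pht t @ rs"] show ?case
    unfolding enc_tr_term by simp
qed

text \<open>Terms contain no formula tag, so rewinding from the end of a comparison finds its own
  tag 11.\<close>

lemma enc_pht_symbols: "set (enc_pht s) \<subseteq> {1..10}"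
proof -
  have "set (enc_nat n) \<subseteq> {1..10}" for n using enc_nat_symbols[of n] by fastforce
  then show ?thesis by (induction s) auto
qed

lemma enc_ph_hd: "\<exists>a w. enc_ph f = a # w \<and> a \<in> {11..15}"
  by (cases f) auto

text \<open>The condition on \<open>rs\<close> lets a final comparison detect its end. The factor 4
  pays for two readings and one rewinding.\<close>

lemma reach_main:
  assumes "rs = a # rs'" "a \<in> {11..15} \<union> {28}"
  shows "reach (dstep (transduce e)) (4 * length (enc_ph f)) (Main, ls, enc_ph f @ rs, out)
     (Main, rev (enc_ph f) @ ls, rs, out @ enc_ct (tr e f))"
  using assms
proof (induction f arbitrary: ls rs a rs' out)
  case (PLe s t)
  define w where "w = enc_pht s @ enc_pht t"
  define v where "v = enc_ct (tr_term s) @ enc_ct (tr_term t)"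
  have w: "reach (dstep (transduce e)) (length w) (Term c, ls, w @ rs, out) (Term c, rev w @ ls, rs, out @ v)"
    for c ls out
    using reach_trans[OF reach_term[where rs = "enc_pht t @ rs"] reach_term] by (simp add: w_def v_def)
  have "set w \<subseteq> {1..10}" using enc_pht_symbols[of s] enc_pht_symbols[of t] by (auto simp: w_def)
  moreover obtain r w' where w': "rev w = r # w'"
  proof (cases "rev w")
    case Nil
    then show ?thesis by (cases s) (auto simp: w_def)
  qed
  ultimately have rw: "set (r # w') \<inter> {0, 11} = {}"
    using set_rev[of w] by (fastforce simp del: set_rev)
  have a: "a \<notin> {0, 1, 2, 3, 8, 9, 10}" using PLe(2) by auto
  have r: "rev w' @ r # rs = w @ rs" using arg_cong[OF w', of rev] by simp
  have 1: "reach (dstep (transduce e)) (Suc (length w)) (Main, ls, 11 # w @ rs, out)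
      (Term False, rev w @ 11 # ls, rs, (out @ leP e) @ v)"
    by (rule reach_dstep[OF _ _ w]) auto
  have 2: "reach (dstep (transduce e)) (Suc (length w' + 2)) (Term False, rev w @ 11 # ls, rs, (out @ leP e) @ v)
      (Term True, 11 # ls, w @ rs, (((out @ leP e) @ v) @ []) @ flipB @ [23])"
    unfolding PLe(1) r[symmetric, unfolded PLe(1)]
    by (rule reach_dstep[OF _ _ reach_rewind]) (use a w' rw in auto)
  have 3: "reach (dstep (transduce e)) (length w) (Term True, 11 # ls, w @ rs, (((out @ leP e) @ v) @ []) @ flipB @ [23])
      (Term True, rev w @ 11 # ls, rs, ((((out @ leP e) @ v) @ []) @ flipB @ [23]) @ v)"
    by (rule w)
  have 4: "reach (dstep (transduce e)) (Suc 0) (Term True, rev w @ 11 # ls, rs, ((((out @ leP e) @ v) @ []) @ flipB @ [23]) @ v)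
      (Main, rev w @ 11 # ls, rs, (((((out @ leP e) @ v) @ []) @ flipB @ [23]) @ v) @ [])"
    unfolding PLe(1) by (rule reach_dstep[OF _ _ reach_refl]) (use a in auto)
  have "length w = Suc (length w')" using arg_cong[OF w', of length] by simp
  then have len: "Suc (length w) + (Suc (length w' + 2) + (length w + Suc 0)) \<le> 4 * length (enc_ph (PLe s t))"
    by (simp add: w_def)
  show ?case
    using reach_mono[OF reach_trans[OF 1 reach_trans[OF 2 reach_trans[OF 3 4]]] len]
    by (simp add: w_def v_def enc_tr del: tr.simps)
next
  case (PNot f)
  from reach_mono[OF reach_dstep[OF _ _ PNot.IH[OF PNot.prems, of "12 # ls" "out @ notP"],
      of Main 12 Rgt ls "enc_ph f @ rs"], of "4 * length (enc_ph (PNot f))"] show ?case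
    by (simp add: enc_tr del: tr.simps)
next
  case (PAnd f g)
  obtain b w where g: "enc_ph g @ rs = b # w" "b \<in> {11..15} \<union> {28}" using enc_ph_hd[of g] by auto
  from reach_mono[OF reach_dstep[OF _ _ reach_trans[OF PAnd.IH(1)[OF g, of "13 # ls" "out @ andP"]
      PAnd.IH(2)[OF PAnd.prems]], of Main 13 Rgt ls "enc_ph f @ enc_ph g @ rs"],
      of "4 * length (enc_ph (PAnd f g))"] show ?case
    by (simp add: enc_tr del: tr.simps)
next
  case (PEx x f)
  have 1: "reach (dstep (transduce e)) (length (enc_nat x)) (BoundNum, 14 # ls, enc_nat x @ enc_ph f @ rs, out @ exP e)
     (Main, rev (enc_nat x) @ 14 # ls, enc_ph f @ rs, (out @ exP e) @ enc_nat x @ holdsP)"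
    by (rule reach_copy[where d = Rgt]) (simp_all add: enc_nat_def)
  from reach_mono[OF reach_dstep[OF _ _ reach_trans[OF 1 PEx.IH[OF PEx.prems]],
      of Main 14 Rgt ls "enc_nat x @ enc_ph f @ rs"], of "4 * length (enc_ph (PEx x f))"] show ?case
    by (simp add: enc_tr del: tr.simps)
next
  case (PHaertig x y f)
  let ?R = "enc_nat y @ enc_ph f @ rs"
  let ?o1 = "out @ htermA e @ flipA @ beforeA"
  let ?o2 = "?o1 @ enc_nat x @ beforeB @ flipB @ beforeA"
  let ?o3 = "(?o2 @ []) @ enc_nat x @ beforeB @ htermB"
  have 1: "reach (dstep (transduce e)) (length (enc_nat x)) (Haertig False, 15 # ls, enc_nat x @ ?R, ?o1)
     (HaertigBack, rev (bits x) @ 15 # ls, 3 # ?R, ?o2)"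
    by (rule reach_copy[where d = Stay]) simp_all
  \<comment> \<open>No digit is 15, so \<open>HaertigBack\<close> stops at the tag of this very
    quantifier.\<close>
  have "set (3 # rev (bits x)) \<inter> {0, 15} = {}" using set_bits[of x] by fastforce
  then have 2: "reach (dstep (transduce e)) (length (rev (bits x)) + 2) (HaertigBack, rev (bits x) @ 15 # ls, 3 # ?R, ?o2)
     (Haertig True, 15 # ls, rev (rev (bits x)) @ 3 # ?R, ?o2 @ [])"
    by (intro reach_rewind) simp_all
  have 3: "reach (dstep (transduce e)) (length (enc_nat x)) (Haertig True, 15 # ls, enc_nat x @ ?R, ?o2 @ [])
     (BoundNum, rev (enc_nat x) @ 15 # ls, ?R, ?o3)"
    by (rule reach_copy[where d = Rgt]) (simp_all add: enc_nat_def)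
  have 4: "reach (dstep (transduce e)) (length (enc_nat y)) (BoundNum, rev (enc_nat x) @ 15 # ls, ?R, ?o3)
     (Main, rev (enc_nat y) @ rev (enc_nat x) @ 15 # ls, enc_ph f @ rs, ?o3 @ enc_nat y @ holdsP)"
    by (rule reach_copy[where d = Rgt]) (simp_all add: enc_nat_def)
  have "rev (rev (bits x)) @ 3 # ?R = enc_nat x @ ?R" by (simp add: enc_nat_def)
  note 12 = reach_trans[OF 1 2[unfolded this]]
  note 5 = reach_trans[OF 12 reach_trans[OF 3 reach_trans[OF 4 PHaertig.IH[OF PHaertig.prems]]]]
  have len: "length (bits x) \<le> length (enc_nat x)" by (simp add: enc_nat_def)
  from reach_mono[OF reach_dstep[OF _ _ 5, of Main 15 Rgt ls "enc_nat x @ ?R"],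
      of "4 * length (enc_ph (PHaertig x y f))"] len show ?case
    by (simp add: enc_tr del: tr.simps)
qed

section \<open>The sweep that emits the closure\<close>

abbreviation quants :: "bool \<Rightarrow> nat list \<Rightarrow> nat list" where
  "quants e xs \<equiv> concat (map (\<lambda>x. exP e @ enc_nat x @ holdsP) xs)"

lemma reach_close_num:
  "reach (dstep (transduce e)) (length (enc_nat n)) (Close, ls, enc_nat n @ rs, out)
     (Close, rev (enc_nat n) @ ls, rs, out @ quants e [n])"
proof (cases "bits n")
  case Nil
  then have "reach (dstep (transduce e)) (Suc 0) (Close, ls, enc_nat n @ rs, out)
     (Close, rev (enc_nat n) @ ls, rs, out @ quants e [n])"
    by (simp add: enc_nat_def) (rule reach_dstep[OF _ _ reach_refl], auto)
  then show ?thesis using Nil by (simp add: enc_nat_def)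
next
  case (Cons a w)
  have aw: "a \<in> {1, 2}" "set w \<subseteq> {1, 2}" using set_bits[of n] Cons by auto
  have 1: "reach (dstep (transduce e)) (length w) (CloseNum, a # ls, w @ 3 # rs, out @ exP e @ [a])
     (CloseNum, rev w @ a # ls, 3 # rs, (out @ exP e @ [a]) @ w)"
    by (rule reach_copy_bits[OF _ aw(2)]) simp
  have 2: "reach (dstep (transduce e)) (Suc 0) (CloseNum, rev w @ a # ls, 3 # rs, (out @ exP e @ [a]) @ w)
     (Close, 3 # rev w @ a # ls, rs, ((out @ exP e @ [a]) @ w) @ 3 # holdsP)"
    by (rule reach_dstep[where d = Rgt, OF _ _ reach_refl]) (simp_all add: copy_def)
  from reach_dstep[OF _ _ reach_trans[OF 1 2], of Close a Rgt ls "w @ 3 # rs"] show ?thesis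
    using aw(1) by (auto simp: enc_nat_def Cons)
qed

lemma reach_close_skip:
  assumes "reach (dstep (transduce e)) n (Close, a # ls, rs, out) c" "a \<in> {8..15}"
  shows "reach (dstep (transduce e)) (Suc n) (Close, ls, a # rs, out) c"
  by (rule reach_dstep[where u = "[]" and d = Rgt]) (use assms in auto)

lemma reach_close_term:
  "reach (dstep (transduce e)) (length (enc_pht s)) (Close, ls, enc_pht s @ rs, out)
     (Close, rev (enc_pht s) @ ls, rs, out @ quants e (nums_term s))"
proof (induction s arbitrary: ls rs out)
  case (PConst a)
  from reach_close_skip[OF reach_close_num[where ls = "8 # ls"]] show ?case by simp
next
  case (PMul a x)
  from reach_close_skip[OF reach_trans[OF reach_close_num[where ls = "9 # ls" and rs = "enc_nat x @ rs"] reach_close_num]]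
  show ?case by simp
next
  case (PAdd s t)
  from reach_close_skip[OF reach_trans[OF PAdd.IH(1)[of "10 # ls" "enc_pht t @ rs"] PAdd.IH(2)]]
  show ?case by simp
qed

lemma reach_close:
  "reach (dstep (transduce e)) (length (enc_ph f)) (Close, ls, enc_ph f @ rs, out)
     (Close, rev (enc_ph f) @ ls, rs, out @ quants e (nums f))"
proof (induction f arbitrary: ls rs out)
  case (PLe s t)
  from reach_close_skip[OF reach_trans[OF reach_close_term[where ls = "11 # ls" and rs = "enc_pht t @ rs"] reach_close_term]]
  show ?case by simp
next
  case (PNot f)
  from reach_close_skip[OF PNot.IH[of "12 # ls"]] show ?case by simp
next
  case (PAnd f g)
  from reach_close_skip[OF reach_trans[OF PAnd.IH(1)[of "13 # ls" "enc_ph g @ rs"] PAnd.IH(2)]]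
  show ?case by simp
next
  case (PEx x f)
  from reach_close_skip[OF reach_trans[OF reach_close_num[where ls = "14 # ls" and rs = "enc_ph f @ rs"] PEx.IH]]
  show ?case by simp
next
  case (PHaertig x y f)
  from reach_close_skip[OF reach_trans[OF reach_close_num[where ls = "15 # ls" and rs = "enc_nat y @ enc_ph f @ rs"]
      reach_trans[OF reach_close_num[where rs = "enc_ph f @ rs"] PHaertig.IH]]]
  show ?case by simp
qed

section \<open>The reduction runs in exponential time\<close>

lemma exptime_reduct: "exptime_computable enc_ph enc_inst (reduct e)"
\<comment> \<open>One pass for the closure, one for the rewinding, and four for the formula.\<close>
proof (rule exptime_computableI[where c = 6])
  show "transduce e Main 28 = None" by simp
  show "set (enc_ph f) \<subseteq> {1..27}" for f by (rule enc_ph_symbols)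
  fix f
  let ?w = "enc_ph f"
  let ?o1 = "[] @ enc_kripke loop @ holdsP"
  let ?o2 = "?o1 @ quants e (nums f)"
  have 1: "reach (dstep (transduce e)) (Suc (length ?w)) (Start, [], 0 # ?w @ [28], [])
     (Close, rev ?w @ [0], [28], ?o2)"
    by (rule reach_dstep[OF _ _ reach_close]) auto
  have "set (28 # rev ?w) \<inter> {0, 0} = {}" using enc_ph_symbols[of f] by fastforce
  then have 2: "reach (dstep (transduce e)) (Suc (length (rev ?w) + 2)) (Close, rev ?w @ [0], [28], ?o2)
     (Main, 0 # [], rev (rev ?w) @ [28], (?o2 @ []) @ [])"
    by (intro reach_dstep[OF _ _ reach_rewind]) auto
  have 3: "reach (dstep (transduce e)) (4 * length ?w) (Main, [0], ?w @ [28], ?o2)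
     (Main, rev ?w @ [0], [28], ?o2 @ enc_ct (tr e f))"
    by (rule reach_main) auto
  have "reach (dstep (transduce e)) (Suc (length ?w) + (Suc (length ?w + 2) + 4 * length ?w))
     (Start, [], 0 # ?w @ [28], []) (Main, rev ?w @ [0], [28], enc_inst (reduct e f))"
    using reach_trans[OF 1 reach_trans[OF 2[unfolded rev_rev_ident length_rev append_Nil2] 3]]
    unfolding enc_reduct by simp
  then show "\<exists>ls. reach (dstep (transduce e)) (6 * (length ?w + 2)) (Start, [], 0 # ?w @ [28], [])
     (Main, ls, [28], enc_inst (reduct e f))"
    by - (rule exI, erule reach_mono, simp)
qed

theorem theorem13:
  shows "(\<exists>f :: ph \<Rightarrow> kripke \<times> cf.
            exptime_computable enc_ph enc_inst f \<and>
            (\<forall>\<Phi>. ks_wf (fst (f \<Phi>)) \<and> flat (fst (f \<Phi>)) \<and> is_cltl (snd (f \<Phi>)) \<and>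
                  (ph_satisfiable \<Phi> \<longleftrightarrow> models (fst (f \<Phi>)) (snd (f \<Phi>)))))
       \<and> (\<exists>f :: ph \<Rightarrow> kripke \<times> cf.
            exptime_computable enc_ph enc_inst f \<and>
            (\<forall>\<Phi>. ks_wf (fst (f \<Phi>)) \<and> flat (fst (f \<Phi>)) \<and> is_cctl (snd (f \<Phi>)) \<and>
                  (ph_satisfiable \<Phi> \<longleftrightarrow> models (fst (f \<Phi>)) (snd (f \<Phi>)))))"
proof -
  have K: "fst (reduct e f) = loop" for e f by (simp add: reduct_def)
  have "exptime_computable enc_ph enc_inst (reduct False) \<and>
    (\<forall>f. ks_wf (fst (reduct False f)) \<and> flat (fst (reduct False f)) \<and> is_cltl (snd (reduct False f)) \<and>
      (ph_satisfiable f \<longleftrightarrow> models (fst (reduct False f)) (snd (reduct False f))))"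
    using exptime_reduct is_cltl_reduct reduct_correct ks_wf_loop flat_loop by (simp add: K)
  moreover have "exptime_computable enc_ph enc_inst (reduct True) \<and>
    (\<forall>f. ks_wf (fst (reduct True f)) \<and> flat (fst (reduct True f)) \<and> is_cctl (snd (reduct True f)) \<and>
      (ph_satisfiable f \<longleftrightarrow> models (fst (reduct True f)) (snd (reduct True f))))"
    using exptime_reduct is_cctl_reduct reduct_correct ks_wf_loop flat_loop by (simp add: K)
  ultimately show ?thesis by blast
qed

end
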